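(* Let $a\in C^1(\mathbb{R})$ be $1$-periodic and uniformly positive, let $0<\varepsilon\le\eta$, $\alpha=\varepsilon/\eta$, and let $K$ be an averaging kernel. Let $F_{\rm HMM}(\alpha)$ and $W(k,\alpha)$ be the averaged flux and the function defined in the context, and suppose that $W(\cdot,\alpha)\in L^2(-\pi,\pi)$. (i) If the initial data $Q\in L^2(\mathbb{R})$ is band limited, i.e. $Q(x)=\int_{\mathbb{R}}\hat Q(k)e^{ixk}\,dk$ with $\operatorname{supp}\hat Q\subset[-\pi/\varepsilon,\pi/\varepsilon]$, then $$F_{\rm HMM}(\alpha)=\frac1\varepsilon\int_{\mathbb{R}}\hat Q(k)\,W(\varepsilon k,\alpha)\,dk .$$ (ii) Moreover, if $Q$ is a polynomial of degree $r$ and $W(\cdot,\alpha)\in C^r(-\pi,\pi)$, then $$F_{\rm HMM}(\alpha)=\varepsilon^{-1}a_0(\alpha)Q(0)+a_1(\alpha)Q'(0)+\varepsilon a_2(\alpha)Q''(0)+\cdots+\varepsilon^{r-1}a_r(\alpha)\,\partial_x^rQ(0),$$ where $$a_j(\alpha)=\frac{i^{-j}}{j!}\,\partial_k^jW(0,\alpha),\qquad 0\le j\le r .$$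
   Context: Kernels: $\mathbb{K}^{p,q}$ is the set of real functions $K\in C^q_c(\mathbb{R})$ with $\operatorname{supp}K\subset[-1,1]$, $\int K(x)\,dx=1$ and $\int K(x)x^j\,dx=0$ for $1\le j\le p$. A kernel is an element $K\in\mathbb{K}^{p,q}$ with $q\ge1$, and $K_\eta(x)=\eta^{-1}K(x/\eta)$. HMM flux: for initial data $Q$, let $v^\varepsilon(t,x)$ solve on the whole line $$v^\varepsilon_{tt}=\partial_x\big(a(x/\varepsilon)\partial_xv^\varepsilon\big),\qquad v^\varepsilon(0,x)=Q(x),\quad v^\varepsilon_t(0,x)=0,$$ and set $$F_{\rm HMM}(\alpha)=\iint K_\eta(x)K_\eta(t)\,a(x/\varepsilon)\,\partial_xv^\varepsilon(t,x)\,dx\,dt .$$ (For polynomial $Q$, which is not in $L^2$, the solution is well defined by finite speed of propagation.) Bloch waves: for each $k\in[-\pi,\pi]$ let $\omega_m^2(k)$ ($\omega_m\ge0$, $0\le\omega_0^2\le\omega_1^2\le\cdots$) and $\psi_m(\cdot,k)$, $m=0,1,2,\dots$, be the eigenvalues and eigenfunctions, $1$-periodic in $y$, of $$-(\partial_y+ik)\,a(y)\,(\partial_y+ik)\psi=\omega^2(k)\psi,$$ with $\{\psi_m(\cdot,k)\}_{m\ge0}$ an orthonormal basis of $L^2(-1/2,1/2)$; $\psi_0(y,0)\equiv1$ and $\omega_0(0)=0$. Definitions (${}^*$ is complex conjugation): $$b_m(k)=\int_{-1/2}^{1/2}\psi_m^*(x,k)\,dx,\qquad s_m(k,\alpha)=\int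 K_\eta(t)\cos\!\big(\omega_m(k)t/\varepsilon\big)\,dt,$$ $$w_m(k,\alpha)=\varepsilon\int K_\eta(x)\,a(x/\varepsilon)\,\partial_x\!\big[\psi_m(x/\varepsilon,k)e^{ikx/\varepsilon}\big]\,dx,\qquad W(k,\alpha)=\sum_{m=0}^\infty b_m(k)s_m(k,\alpha)w_m(k,\alpha).$$ By a change of variables $s_m,w_m$, hence $W$, depend on $\varepsilon,\eta$ only through $\alpha$. *)

theory Defs
  imports "HOL-Analysis.Analysis"
begin

definition nth_vderiv :: "nat \<Rightarrow> (real \<Rightarrow> 'a::real_normed_vector) \<Rightarrow> real \<Rightarrow> 'a" where
  "nth_vderiv n f = ((\<lambda>g x. vector_derivative g (at x)) ^^ n) f"

text \<open>Class \<open>C\<^sup>n\<close> on an \<^emph>\<open>open\<close> set of reals; the values of \<open>f\<close> outside \<open>S\<close> are irrelevant.\<close>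

definition Ck_on :: "nat \<Rightarrow> (real \<Rightarrow> 'a::real_normed_vector) \<Rightarrow> real set \<Rightarrow> bool" where
  "Ck_on n f S \<longleftrightarrow>
     (\<forall>j<n. \<forall>x\<in>S. nth_vderiv j f differentiable (at x)) \<and> continuous_on S (nth_vderiv n f)"

definition L2_on :: "real set \<Rightarrow> (real \<Rightarrow> complex) \<Rightarrow> bool" where
  "L2_on S f \<longleftrightarrow>
     set_borel_measurable lborel S f \<and> set_integrable lborel S (\<lambda>x. (cmod (f x))\<^sup>2)"

definition pd_t :: "(real \<Rightarrow> real \<Rightarrow> complex) \<Rightarrow> real \<Rightarrow> real \<Rightarrow> complex" where
  "pd_t v t x = vector_derivative (\<lambda>s. v s x) (at t)"

definition pd_x :: "(real \<Rightarrow> real \<Rightarrow> complex) \<Rightarrow> real \<Rightarrow> real \<Rightarrow> complex" where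
  "pd_x v t x = vector_derivative (\<lambda>y. v t y) (at x)"

definition C1_plane :: "(real \<Rightarrow> real \<Rightarrow> complex) \<Rightarrow> bool" where
  "C1_plane v \<longleftrightarrow>
     (\<forall>t x. (\<lambda>s. v s x) differentiable (at t)) \<and>
     (\<forall>t x. (\<lambda>y. v t y) differentiable (at x)) \<and>
     continuous_on UNIV (\<lambda>(t, x). pd_t v t x) \<and>
     continuous_on UNIV (\<lambda>(t, x). pd_x v t x)"

definition C2_plane :: "(real \<Rightarrow> real \<Rightarrow> complex) \<Rightarrow> bool" where
  "C2_plane v \<longleftrightarrow> C1_plane v \<and> C1_plane (pd_t v) \<and> C1_plane (pd_x v)"

definition kernel_space :: "nat \<Rightarrow> nat \<Rightarrow> (real \<Rightarrow> real) set" where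
  "kernel_space p q = {K. Ck_on q K UNIV \<and> closure {x. K x \<noteq> 0} \<subseteq> {-1..1} \<and>
     (\<integral>x. K x \<partial>lborel) = 1 \<and> (\<forall>j\<in>{1..p}. (\<integral>x. K x * x ^ j \<partial>lborel) = 0)}"

definition scaled_kernel :: "(real \<Rightarrow> real) \<Rightarrow> real \<Rightarrow> real \<Rightarrow> real" where
  "scaled_kernel K \<eta> x = K (x / \<eta>) / \<eta>"

text \<open>Classical solutions on the whole line. The time variable ranges over all of \<open>\<real>\<close>, because
  the averaging in time uses both positive and negative times.\<close>

definition wave_solution ::
  "(real \<Rightarrow> real) \<Rightarrow> real \<Rightarrow> (real \<Rightarrow> complex) \<Rightarrow> (real \<Rightarrow> real \<Rightarrow> complex) \<Rightarrow> bool" where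
  "wave_solution a \<epsilon> Q v \<longleftrightarrow> C2_plane v \<and>
     (\<forall>t x. pd_t (pd_t v) t x = pd_x (\<lambda>t x. of_real (a (x / \<epsilon>)) * pd_x v t x) t x) \<and>
     (\<forall>x. v 0 x = Q x) \<and> (\<forall>x. pd_t v 0 x = 0)"

definition hmm_flux ::
  "(real \<Rightarrow> real) \<Rightarrow> (real \<Rightarrow> real) \<Rightarrow> real \<Rightarrow> real \<Rightarrow> (real \<Rightarrow> real \<Rightarrow> complex) \<Rightarrow> complex" where
  "hmm_flux a K \<epsilon> \<eta> v =
     (\<integral>t. (\<integral>x. of_real (scaled_kernel K \<eta> x * scaled_kernel K \<eta> t * a (x / \<epsilon>)) * pd_x v t x
        \<partial>lborel) \<partial>lborel)"

text \<open>A family of Bloch waves is written \<open>\<psi> m k y\<close> (the wave number precedes the position).\<close>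

definition shifted_deriv :: "real \<Rightarrow> (real \<Rightarrow> complex) \<Rightarrow> real \<Rightarrow> complex" where
  "shifted_deriv k f y = vector_derivative f (at y) + \<i> * of_real k * f y"

definition bloch_eigenpair :: "(real \<Rightarrow> real) \<Rightarrow> real \<Rightarrow> real \<Rightarrow> (real \<Rightarrow> complex) \<Rightarrow> bool" where
  "bloch_eigenpair a k \<mu> \<phi> \<longleftrightarrow> Ck_on 2 \<phi> UNIV \<and> (\<forall>y. \<phi> (y + 1) = \<phi> y) \<and>
     (\<forall>y. - shifted_deriv k (\<lambda>z. of_real (a z) * shifted_deriv k \<phi> z) y = of_real \<mu> * \<phi> y)"

definition cell_inner :: "(real \<Rightarrow> complex) \<Rightarrow> (real \<Rightarrow> complex) \<Rightarrow> complex" where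
  "cell_inner f g = (LBINT x:{-1/2<..<1/2}. f x * cnj (g x))"

definition orthonormal_basis_cell :: "(nat \<Rightarrow> real \<Rightarrow> complex) \<Rightarrow> bool" where
  "orthonormal_basis_cell \<phi> \<longleftrightarrow>
     (\<forall>m. L2_on {-1/2<..<1/2} (\<phi> m)) \<and>
     (\<forall>m n. cell_inner (\<phi> m) (\<phi> n) = (if m = n then 1 else 0)) \<and>
     (\<forall>f. L2_on {-1/2<..<1/2} f \<longrightarrow>
        (\<lambda>N. LBINT x:{-1/2<..<1/2}. (cmod (f x - (\<Sum>m<N. cell_inner f (\<phi> m) * \<phi> m x)))\<^sup>2)
          \<longlonglongrightarrow> 0)"

definition bloch_waves ::
  "(real \<Rightarrow> real) \<Rightarrow> (nat \<Rightarrow> real \<Rightarrow> real) \<Rightarrow> (nat \<Rightarrow> real \<Rightarrow> real \<Rightarrow> complex) \<Rightarrow> bool" where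
  "bloch_waves a \<omega> \<psi> \<longleftrightarrow>
     (\<forall>k\<in>{-pi..pi}.
        (\<forall>m. \<omega> m k \<ge> 0 \<and> (\<omega> m k)\<^sup>2 \<le> (\<omega> (Suc m) k)\<^sup>2 \<and> bloch_eigenpair a k ((\<omega> m k)\<^sup>2) (\<psi> m k)) \<and>
        orthonormal_basis_cell (\<lambda>m. \<psi> m k)) \<and>
     (\<forall>y. \<psi> 0 0 y = 1) \<and> \<omega> 0 0 = 0"

definition bloch_b :: "(nat \<Rightarrow> real \<Rightarrow> real \<Rightarrow> complex) \<Rightarrow> nat \<Rightarrow> real \<Rightarrow> complex" where
  "bloch_b \<psi> m k = (LBINT x:{-1/2..1/2}. cnj (\<psi> m k x))"

definition bloch_s ::
  "(real \<Rightarrow> real) \<Rightarrow> real \<Rightarrow> real \<Rightarrow> (nat \<Rightarrow> real \<Rightarrow> real) \<Rightarrow> nat \<Rightarrow> real \<Rightarrow> real" where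
  "bloch_s K \<epsilon> \<eta> \<omega> m k = (\<integral>t. scaled_kernel K \<eta> t * cos (\<omega> m k * t / \<epsilon>) \<partial>lborel)"

definition bloch_w ::
  "(real \<Rightarrow> real) \<Rightarrow> (real \<Rightarrow> real) \<Rightarrow> real \<Rightarrow> real \<Rightarrow> (nat \<Rightarrow> real \<Rightarrow> real \<Rightarrow> complex)
    \<Rightarrow> nat \<Rightarrow> real \<Rightarrow> complex" where
  "bloch_w a K \<epsilon> \<eta> \<psi> m k = of_real \<epsilon> *
     (\<integral>x. of_real (scaled_kernel K \<eta> x * a (x / \<epsilon>)) *
        vector_derivative (\<lambda>z. \<psi> m k (z / \<epsilon>) * exp (\<i> * of_real (k * z / \<epsilon>))) (at x) \<partial>lborel)"

text \<open>The function \<open>W(k,\<alpha>)\<close> with \<open>\<alpha> = \<epsilon> / \<eta>\<close>: the two scales enter the formulas separately, but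
  the values depend on them only through their ratio.\<close>

definition bloch_W ::
  "(real \<Rightarrow> real) \<Rightarrow> (real \<Rightarrow> real) \<Rightarrow> real \<Rightarrow> real \<Rightarrow> (nat \<Rightarrow> real \<Rightarrow> real)
    \<Rightarrow> (nat \<Rightarrow> real \<Rightarrow> real \<Rightarrow> complex) \<Rightarrow> real \<Rightarrow> complex" where
  "bloch_W a K \<epsilon> \<eta> \<omega> \<psi> k =
     (\<Sum>m. bloch_b \<psi> m k * of_real (bloch_s K \<epsilon> \<eta> \<omega> m k) * bloch_w a K \<epsilon> \<eta> \<psi> m k)"

definition flux_coeff :: "(real \<Rightarrow> complex) \<Rightarrow> nat \<Rightarrow> complex" where
  "flux_coeff W j = \<i> powi (- int j) / fact j * nth_vderiv j W 0"

text \<open>For square-integrable \<open>Q\<close>, integrability of \<open>Qhat\<close> is no restriction: a square-integrable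
  function with bounded support is integrable. It makes the Fourier integral meaningful.\<close>

definition band_limited :: "real \<Rightarrow> (real \<Rightarrow> complex) \<Rightarrow> (real \<Rightarrow> complex) \<Rightarrow> bool" where
  "band_limited B Q Qhat \<longleftrightarrow> L2_on UNIV Q \<and> integrable lborel Qhat \<and>
     closure {k. Qhat k \<noteq> 0} \<subseteq> {-B..B} \<and>
     (\<forall>x. Q x = (\<integral>k. Qhat k * exp (\<i> * of_real (x * k)) \<partial>lborel))"

end

theory Submission
  imports Defs
begin

text \<open>Written as a first order system for \<open>v\<close> and \<open>H = \<integral>\<^sub>0\<^sup>t a \<partial>\<^sub>x v ds\<close>, the wave equation has an
  energy that is controlled, on backward light cones, by the \<open>L\<^sup>2\<close> norm of \<open>Q\<close> alone. One integration
  by parts in \<open>t\<close> expresses the flux through \<open>H\<close>, so the flux is a bounded linear functional of the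
  data in \<open>L\<^sup>2(-R, R)\<close>, for a fixed \<open>R\<close>. On partial sums of the Bloch expansion of
  \<open>e\<^sup>i\<^sup>k\<^sup>x\<^sup>/\<^sup>\<epsilon>\<close> the flux is explicit, and these sums converge in \<open>L\<^sup>2(-R, R)\<close>; hence the series
  for \<open>W(k)\<close> converges, \<open>e\<^sup>i\<^sup>k\<^sup>x\<^sup>/\<^sup>\<epsilon>\<close> has flux \<open>W(k)/\<epsilon>\<close>, and \<open>W\<close> is Lipschitz on \<open>[-\<pi>, \<pi>]\<close>. Part (i)
  follows by approximating the Fourier integral by Riemann sums, part (ii) by differentiating
  \<open>e\<^sup>i\<^sup>k\<^sup>x\<^sup>/\<^sup>\<epsilon>\<close> in \<open>k\<close> at \<open>k = 0\<close> through difference quotients.\<close>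

section \<open>Functions of class \<open>C\<^sup>1\<close> on the plane\<close>

text \<open>The obstacle is a mismatch of norms: the Bloch series of a plane wave converges only in
  the mean square over a cell, while the flux contains the x-derivative of \<open>v\<close>, which
  the usual wave energy would control only through the derivative of \<open>Q\<close>. The way out
  is that \<open>A * pd_x v\<close> is itself a time derivative, that of \<open>H\<close>, and that
  the averaging kernel is C^1 and can absorb it. The interval [-R, R] depends only on the support of
  the kernel and on the largest wave speed; hence the bound is uniform in the data and makes sense
  for plane waves and polynomials, which are not square integrable on the line. Integrals over k and
  derivatives in k of solutions are never shown to be solutions. Only finite linear combinations of
  separated solutions occur, followed by limits in the mean square on [-R, R]. The given solution
  enters at the end, because the flux extends uniquely to such limits.\<close>

lemma continuous_on_has_vector_derivative:
  assumes "\<And>x. (f has_vector_derivative f' x) (at x)"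
  shows "continuous_on S f"
  using has_vector_derivative_continuous[OF assms] by (simp add: continuous_at_imp_continuous_on)

lemma C1_plane_pd_t:
  assumes "C1_plane v"
  shows "((\<lambda>s. v s x) has_vector_derivative pd_t v t x) (at t within S)"
  using assms vector_derivative_works has_vector_derivative_at_within
  unfolding C1_plane_def pd_t_def by blast

lemma C1_plane_pd_x:
  assumes "C1_plane v"
  shows "((\<lambda>y. v t y) has_vector_derivative pd_x v t x) (at x within S)"
  using assms vector_derivative_works has_vector_derivative_at_within
  unfolding C1_plane_def pd_x_def by blast

lemma continuous_on_pd_t:
  assumes "C1_plane v" "continuous_on S f" "continuous_on S g"
  shows "continuous_on S (\<lambda>z. pd_t v (f z) (g z))"
proof -
  have "continuous_on UNIV (\<lambda>(t, x). pd_t v t x)"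
    using assms(1) by (simp add: C1_plane_def)
  from continuous_on_compose2[OF this continuous_on_Pair[OF assms(2,3)]] show ?thesis by simp
qed

lemma continuous_on_pd_x:
  assumes "C1_plane v" "continuous_on S f" "continuous_on S g"
  shows "continuous_on S (\<lambda>z. pd_x v (f z) (g z))"
proof -
  have "continuous_on UNIV (\<lambda>(t, x). pd_x v t x)"
    using assms(1) by (simp add: C1_plane_def)
  from continuous_on_compose2[OF this continuous_on_Pair[OF assms(2,3)]] show ?thesis by simp
qed

lemma C1_planeI:
  assumes t: "\<And>t x. ((\<lambda>s. v s x) has_vector_derivative vt t x) (at t)"
    and x: "\<And>t x. ((\<lambda>y. v t y) has_vector_derivative vx t x) (at x)"
    and ct: "continuous_on UNIV (\<lambda>(t, x). vt t x)"
    and cx: "continuous_on UNIV (\<lambda>(t, x). vx t x)"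
  shows "C1_plane v" and "pd_t v = vt" and "pd_x v = vx"
proof -
  show 1: "pd_t v = vt"
    by (intro ext) (simp add: pd_t_def vector_derivative_at[OF t])
  show 2: "pd_x v = vx"
    by (intro ext) (simp add: pd_x_def vector_derivative_at[OF x])
  show "C1_plane v"
    unfolding C1_plane_def 1 2 using t x ct cx differentiableI_vector by blast
qed

text \<open>\<open>C1_plane\<close> demands joint continuity of the partial derivatives only. They
  yield total differentiability, and joint continuity of \<open>v\<close> follows from that.\<close>

lemma continuous_on_C1_plane:
  assumes v: "C1_plane v" and f: "continuous_on S f" and g: "continuous_on S g"
  shows "continuous_on S (\<lambda>z. v (f z) (g z))"
proof -
  have "continuous (at (t, x)) (\<lambda>(t, x). v t x)" for t x
  proof -
    have "((\<lambda>(t, x). v t x) has_derivative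
        (\<lambda>(r, y). r *\<^sub>R pd_t v t x + blinfun_scaleR_left (pd_x v t x) y)) (at (t, x) within UNIV \<times> UNIV)"
    proof (rule has_derivative_partialsI)
      show "((\<lambda>s. v s x) has_derivative (\<lambda>r. r *\<^sub>R pd_t v t x)) (at t)"
        using C1_plane_pd_t[OF v] unfolding has_vector_derivative_def .
      show "((\<lambda>y. v t y) has_derivative blinfun_scaleR_left (pd_x v t x)) (at x)" for t x
        using C1_plane_pd_x[OF v] unfolding has_vector_derivative_def by simp
      have "continuous_on UNIV (\<lambda>z. pd_x v (fst z) (snd z))"
        by (intro continuous_on_pd_x v continuous_intros)
      then have "continuous_on UNIV (\<lambda>z. blinfun_scaleR_left (pd_x v (fst z) (snd z)))"
        by (intro continuous_intros)
      then show "continuous (at (t, x) within UNIV \<times> UNIV) (\<lambda>(t, x). blinfun_scaleR_left (pd_x v t x))"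
        by (simp add: continuous_on_eq_continuous_within case_prod_beta')
    qed auto
    then show ?thesis
      using has_derivative_continuous by auto
  qed
  then have "continuous_on UNIV (\<lambda>(t, x). v t x)"
    by (auto simp: continuous_on_eq_continuous_within)
  from continuous_on_compose2[OF this continuous_on_Pair[OF f g]] show ?thesis by simp
qed

lemmas C1_plane_continuous_intros =
  continuous_on_pd_t continuous_on_pd_x continuous_on_C1_plane

text \<open>Substituting \<open>s = t u\<close> in \<open>\<integral>\<^sub>0\<^sup>t f s x ds\<close> treats both signs of \<open>t\<close> at once.\<close>

definition time_integral :: "(real \<Rightarrow> real \<Rightarrow> complex) \<Rightarrow> real \<Rightarrow> real \<Rightarrow> complex" where
  "time_integral f t x = t *\<^sub>R integral {0..1} (\<lambda>u. f (t * u) x)"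

text \<open>The symmetric interval contains 0 and t whatever the sign of t, and one-sided
  derivatives at its ends are all that an antiderivative on a closed interval provides.\<close>

lemma time_integral_antiderivative:
  assumes T: "\<bar>t\<bar> \<le> T"
    and g: "\<And>s. s \<in> {-T..T} \<Longrightarrow> (g has_vector_derivative f s x) (at s within {-T..T})"
  shows "time_integral f t x = g t - g 0"
proof -
  have im: "(\<lambda>u. t * u) ` {0..1} \<subseteq> {-T..T}"
  proof safe
    fix u :: real assume "u \<in> {0..1}"
    then have "\<bar>t * u\<bar> \<le> \<bar>t\<bar> * 1" unfolding abs_mult by (intro mult_left_mono) auto
    with T show "t * u \<in> {-T..T}" by auto
  qed
  have "((\<lambda>u. t *\<^sub>R f (t * u) x) has_integral g (t * 1) - g (t * 0)) {0..1}"
  proof (rule fundamental_theorem_of_calculus)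
    fix u :: real assume u: "u \<in> {0..1}"
    have "((\<lambda>u. t * u) has_vector_derivative t) (at u within {0..1})"
      by (auto intro!: derivative_eq_intros)
    moreover have "(g has_vector_derivative f (t * u) x) (at (t * u) within (\<lambda>u. t * u) ` {0..1})"
      using im u by (intro has_vector_derivative_within_subset[OF g im]) blast
    ultimately show "((\<lambda>u. g (t * u)) has_vector_derivative t *\<^sub>R f (t * u) x) (at u within {0..1})"
      using vector_diff_chain_within[of "\<lambda>u. t * u" t u "{0..1}" g] by (simp add: o_def)
  qed simp
  from integral_unique[OF this] show ?thesis
    by (simp add: time_integral_def)
qed

lemma time_integral_has_vector_derivative:
  assumes f: "continuous_on UNIV (\<lambda>s. f s x)"
  shows "((\<lambda>s. time_integral f s x) has_vector_derivative f t x) (at t)"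
proof -
  \<comment> \<open>The margin 1 puts \<open>t\<close> in the interior, where the derivative within
    the interval is the full one.\<close>
  define T where "T = \<bar>t\<bar> + 1"
  have "continuous_on {-T..T} (\<lambda>s. f s x)"
    using f continuous_on_subset by blast
  then obtain g where g: "\<And>s. s \<in> {-T..T} \<Longrightarrow>
      (g has_vector_derivative f s x) (at s within {-T..T})"
    using antiderivative_continuous by blast
  have "(g has_vector_derivative f t x) (at t within {-T..T})"
    by (rule g) (auto simp: T_def)
  then have "(g has_vector_derivative f t x) (at t)"
    by (subst (asm) at_within_interior) (auto simp: T_def interior_atLeastAtMost_real)
  then have "((\<lambda>s. g s - g 0) has_vector_derivative f t x) (at t)"
    by (auto intro!: derivative_eq_intros)
  then show ?thesis
  proof (rule has_vector_derivative_transform_within_open)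
    show "open {-T<..<T}" "t \<in> {-T<..<T}" by (auto simp: T_def)
    show "g s - g 0 = time_integral f s x" if "s \<in> {-T<..<T}" for s
      using that by (intro time_integral_antiderivative[where g = g and T = T, symmetric] g) auto
  qed
qed

text \<open>Differentiation under the integral turns the x-derivative of the time integral of
  \<open>f\<close> into the time integral of \<open>pd_t w\<close>, which is \<open>w\<close>
  because \<open>w\<close> vanishes at time 0. It serves with \<open>f\<close> the flux density and
  \<open>w\<close> the velocity.\<close>

lemma C1_plane_time_integral:
  assumes f: "continuous_on UNIV (\<lambda>(t, x). f t x)"
    and w: "C1_plane w" and w0: "\<And>x. w 0 x = 0"
    and fx: "\<And>t x. ((\<lambda>y. f t y) has_vector_derivative pd_t w t x) (at x)"
  shows "C1_plane (time_integral f)" and "pd_t (time_integral f) = f"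
    and "pd_x (time_integral f) = w"
proof -
  have ft: "continuous_on UNIV (\<lambda>s. f s x)" for x
    using continuous_on_compose2[OF f continuous_on_Pair[OF continuous_on_id continuous_on_const]]
    by simp
  have dt: "((\<lambda>s. time_integral f s x) has_vector_derivative f t x) (at t)" for t x
    by (rule time_integral_has_vector_derivative[OF ft])
  have dx: "((\<lambda>y. time_integral f t y) has_vector_derivative w t x) (at x)" for t x
  proof -
    have "((\<lambda>y. integral (cbox 0 1) (\<lambda>u. f (t * u) y)) has_vector_derivative
        integral (cbox 0 1) (\<lambda>u. pd_t w (t * u) x)) (at x within UNIV)"
    proof (rule leibniz_rule_vector_derivative)
      show "(\<lambda>u. f (t * u) y) integrable_on cbox 0 1" for y
        by (intro integrable_continuous continuous_on_compose2[OF ft]) (auto intro!: continuous_intros)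
      show "continuous_on (UNIV \<times> cbox 0 1) (\<lambda>(y, u). pd_t w (t * u) y)"
        unfolding case_prod_beta' by (intro C1_plane_continuous_intros w continuous_intros)
    qed (use fx in auto)
    then have "((\<lambda>y. time_integral f t y) has_vector_derivative time_integral (pd_t w) t x) (at x)"
      unfolding time_integral_def by (auto intro!: derivative_eq_intros)
    moreover have "time_integral (pd_t w) t x = w t x - w 0 x"
      by (rule time_integral_antiderivative[of t "\<bar>t\<bar>"]) (auto intro: C1_plane_pd_t[OF w])
    ultimately show ?thesis by (simp add: w0)
  qed
  have cw: "continuous_on UNIV (\<lambda>(t, x). w t x)"
    unfolding case_prod_beta' by (intro C1_plane_continuous_intros w continuous_intros)
  show "C1_plane (time_integral f)" "pd_t (time_integral f) = f" "pd_x (time_integral f) = w"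
    using C1_planeI[OF dt dx f cw] by auto
qed

section \<open>Finite speed of propagation\<close>

text \<open>Squaring smooths the kink of the positive part, so that this cut-off is C^1.\<close>

definition pos_sq :: "real \<Rightarrow> real" where
  "pos_sq y = (max 0 y)\<^sup>2"

lemma pos_sq_nonneg [simp]: "0 \<le> pos_sq y"
  by (simp add: pos_sq_def)

lemma pos_sq_nonpos_arg: "y \<le> 0 \<Longrightarrow> pos_sq y = 0"
  by (simp add: pos_sq_def)

lemma DERIV_pos_sq: "(pos_sq has_real_derivative 2 * max 0 y) (at y)"
proof -
  consider "y > 0" | "y < 0" | "y = 0" by linarith
  then show ?thesis
  proof cases
    case 1
    have "((\<lambda>y. y\<^sup>2) has_real_derivative 2 * max 0 y) (at y)"
      using 1 by (auto intro!: derivative_eq_intros)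
    then show ?thesis
      by (rule has_field_derivative_transform_within_open[of _ _ _ "{0<..}"])
        (use 1 in \<open>auto simp: pos_sq_def\<close>)
  next
    case 2
    have "((\<lambda>y. 0) has_real_derivative 2 * max 0 y) (at y)"
      using 2 by (auto intro!: derivative_eq_intros)
    then show ?thesis
      by (rule has_field_derivative_transform_within_open[of _ _ _ "{..<0}"])
        (use 2 in \<open>auto simp: pos_sq_def\<close>)
  next
    case 3
    have "(\<lambda>h. pos_sq h / h) \<midarrow>0\<rightarrow> 0"
    proof (rule Lim_null_comparison)
      show "\<forall>\<^sub>F h in at 0. norm (pos_sq h / h) \<le> \<bar>h\<bar>"
        by (auto simp: pos_sq_def power2_eq_square max_def)
      show "(\<lambda>h::real. \<bar>h\<bar>) \<midarrow>0\<rightarrow> 0"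
        by (auto intro!: tendsto_eq_intros)
    qed
    then show ?thesis using 3 by (simp add: DERIV_def pos_sq_def)
  qed
qed

lemmas DERIV_pos_sq_chain = DERIV_chain2[OF DERIV_pos_sq]

lemma continuous_on_pos_sq: "continuous_on S f \<Longrightarrow> continuous_on S (\<lambda>z. pos_sq (f z))"
  unfolding pos_sq_def by (intro continuous_intros)

text \<open>A \<open>C\<^sup>1\<close> weight supported in the backward light cone of slope \<open>s\<close> over \<open>[-R, R]\<close>; it
  satisfies \<open>\<partial>\<^sub>t \<phi> + s \<bar>\<partial>\<^sub>x \<phi>\<bar> \<le> 0\<close>.\<close>

definition cone_weight :: "real \<Rightarrow> real \<Rightarrow> real \<Rightarrow> real \<Rightarrow> real" where
  "cone_weight s R t x = pos_sq (R - s * t - x) * pos_sq (R - s * t + x)"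

lemma cone_weight_nonneg: "0 \<le> cone_weight s R t x"
  by (simp add: cone_weight_def)

text \<open>Both factors are squares of numbers at least 1 here. This removes the weight at the
  later time.\<close>

lemma cone_weight_ge_1:
  assumes "s * t + \<bar>x\<bar> + 1 \<le> R"
  shows "1 \<le> cone_weight s R t x"
proof -
  have "1 \<le> pos_sq y" if "1 \<le> y" for y
    using that by (simp add: pos_sq_def one_le_power)
  then have "1 * 1 \<le> pos_sq (R - s * t - x) * pos_sq (R - s * t + x)"
    using assms by (intro mult_mono) auto
  then show ?thesis by (simp add: cone_weight_def)
qed

text \<open>Each factor is the square of a number in [0, 2R]. This removes the weight at time
  0.\<close>

lemma cone_weight_0_le:
  assumes "\<bar>x\<bar> \<le> R"
  shows "cone_weight s R 0 x \<le> (2 * R) ^ 4"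
proof -
  have "pos_sq y \<le> (2 * R)\<^sup>2" if "y \<le> 2 * R" for y
    unfolding pos_sq_def using that assms by (intro power_mono) auto
  then have "cone_weight s R 0 x \<le> (2 * R)\<^sup>2 * (2 * R)\<^sup>2"
    unfolding cone_weight_def using assms by (intro mult_mono) auto
  then show ?thesis by (simp add: power2_eq_square power4_eq_xxxx)
qed

lemma continuous_on_cone_weight:
  "continuous_on S f \<Longrightarrow> continuous_on S g \<Longrightarrow> continuous_on S (\<lambda>z. cone_weight s R (f z) (g z))"
  unfolding cone_weight_def by (intro continuous_intros continuous_on_pos_sq)

text \<open>Expand \<open>(s * norm u - norm h)\<^sup>2 / s\<close>. In physical terms, if
  \<open>s\<close> dominates the local wave speed, the energy flux is at most \<open>s\<close> times
  the energy density.\<close>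

lemma power2_norm_scaled_le:
  fixes u h :: "'a::real_inner"
  assumes "0 < A" "A \<le> s\<^sup>2" "0 < s"
  shows "\<bar>2 * inner u h\<bar> \<le> s * (inner u u + inner h h / A)"
proof -
  have "inner h h / s\<^sup>2 \<le> inner h h / A"
    using assms by (intro divide_left_mono) auto
  then have "s * (inner u u + inner h h / s\<^sup>2) \<le> s * (inner u u + inner h h / A)"
    using assms by (intro mult_left_mono) auto
  moreover have "2 * (norm u * norm h) \<le> s * (inner u u + inner h h / s\<^sup>2)"
  proof -
    have "0 \<le> (s * norm u - norm h)\<^sup>2 / s" using assms by simp
    also have "\<dots> = s * (inner u u + inner h h / s\<^sup>2) - 2 * (norm u * norm h)"
      using assms by (simp add: power2_norm_eq_inner[symmetric] field_simps power2_eq_square)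
    finally show ?thesis by simp
  qed
  moreover have "\<bar>2 * inner u h\<bar> \<le> 2 * (norm u * norm h)"
    using Cauchy_Schwarz_ineq2[of u h] by simp
  ultimately show ?thesis by linarith
qed

text \<open>With density \<open>e\<close> and flux 2<v,H>, the system gives the conservation law
  that the t-derivative of \<open>e\<close> is the x-derivative of the flux. After integration by
  parts against the weight, the remaining integrand is nonpositive: the weight decays in time at
  least \<open>s\<close> times as fast as it varies in space, and the flux is at most
  \<open>s * e\<close>.\<close>

lemma weighted_energy_nonincreasing:
  fixes A :: "real \<Rightarrow> real" and v H :: "real \<Rightarrow> real \<Rightarrow> complex" and R :: real
  assumes v: "C1_plane v" and H: "C1_plane H"
    and vt: "\<And>t x. pd_t v t x = pd_x H t x"
    and Ht: "\<And>t x. pd_t H t x = A x *\<^sub>R pd_x v t x"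
    and A: "continuous_on UNIV A" "\<And>x. 0 < A x" "\<And>x. A x \<le> s\<^sup>2"
    and s: "0 < s" and t: "0 \<le> t"
  defines "E \<equiv> \<lambda>t. integral {-R..R} (\<lambda>x. cone_weight s R t x *
                  (inner (v t x) (v t x) + inner (H t x) (H t x) / A x))"
  shows "E t \<le> E 0"
proof (cases "0 \<le> R")
  \<comment> \<open>The interval is empty and both energies are 0.\<close>
  case False
  then show ?thesis by (simp add: E_def)
next
  case R: True
  note cont = continuous_on_pos_sq continuous_on_cone_weight C1_plane_continuous_intros v H
    continuous_on_compose2[OF A(1)] continuous_intros
  define e where "e = (\<lambda>t x. inner (v t x) (v t x) + inner (H t x) (H t x) / A x)"
  \<comment> \<open>The two product-rule terms of the weight: its t-derivative is
    \<open>- s * (q1 + q2)\<close>, its x-derivative \<open>q2 - q1\<close>.\<close>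
  define q1 where "q1 = (\<lambda>t x. 2 * max 0 (R - s * t - x) * pos_sq (R - s * t + x))"
  define q2 where "q2 = (\<lambda>t x. pos_sq (R - s * t - x) * (2 * max 0 (R - s * t + x)))"
  have q_nonneg: "0 \<le> q1 t x" "0 \<le> q2 t x" for t x
    by (auto simp: q1_def q2_def)
  have wt: "((\<lambda>t. cone_weight s R t x) has_real_derivative - s * (q1 t x + q2 t x)) (at t)" for t x
    unfolding cone_weight_def q1_def q2_def
    by (auto intro!: derivative_eq_intros DERIV_pos_sq_chain simp: algebra_simps)
  have wx: "((\<lambda>x. cone_weight s R t x) has_real_derivative q2 t x - q1 t x) (at x)" for t x
    unfolding cone_weight_def q1_def q2_def
    by (auto intro!: derivative_eq_intros DERIV_pos_sq_chain simp: algebra_simps)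
  note inner_deriv = bounded_bilinear.has_vector_derivative[OF bounded_bilinear_inner]
  have et: "((\<lambda>t. e t x) has_real_derivative
      2 * inner (pd_x H t x) (v t x) + 2 * inner (pd_x v t x) (H t x)) (at t)" for t x
  proof -
    have "((\<lambda>t. inner (v t x) (v t x)) has_real_derivative
        2 * inner (pd_x H t x) (v t x)) (at t)"
      using inner_deriv[OF C1_plane_pd_t[OF v, where t = t and x = x and S = UNIV]
          C1_plane_pd_t[OF v, where t = t and x = x and S = UNIV]]
      by (simp add: has_real_derivative_iff_has_vector_derivative vt inner_commute)
    moreover have "((\<lambda>t. inner (H t x) (H t x)) has_real_derivative
        2 * A x * inner (pd_x v t x) (H t x)) (at t)"
      using inner_deriv[OF C1_plane_pd_t[OF H, where t = t and x = x and S = UNIV]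
          C1_plane_pd_t[OF H, where t = t and x = x and S = UNIV]]
      by (simp add: has_real_derivative_iff_has_vector_derivative Ht inner_commute algebra_simps)
    ultimately show ?thesis
      unfolding e_def using A(2)[of x] by (auto intro!: derivative_eq_intros)
  qed
  have fx: "((\<lambda>y. 2 * inner (v t y) (H t y)) has_real_derivative
      2 * inner (pd_x H t x) (v t x) + 2 * inner (pd_x v t x) (H t x)) (at x)" for t x
  proof -
    have "((\<lambda>y. inner (v t y) (H t y)) has_real_derivative
        inner (pd_x H t x) (v t x) + inner (pd_x v t x) (H t x)) (at x)"
      using inner_deriv[OF C1_plane_pd_x[OF v, where t = t and x = x and S = UNIV]
          C1_plane_pd_x[OF H, where t = t and x = x and S = UNIV]]
      by (simp add: has_real_derivative_iff_has_vector_derivative inner_commute)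
    then show ?thesis by (auto intro!: derivative_eq_intros)
  qed
  \<comment> \<open>\<open>d\<close> is the t-derivative of weight times density, \<open>g\<close>
    the x-derivative of weight times flux. By the conservation law their last summands agree, so
    only the derivatives of the weight enter the comparison \<open>d \<le> g\<close>.\<close>
  define d where "d = (\<lambda>t x. - s * (q1 t x + q2 t x) * e t x + cone_weight s R t x *
      (2 * inner (pd_x H t x) (v t x) + 2 * inner (pd_x v t x) (H t x)))"
  define g where "g = (\<lambda>t x. (q2 t x - q1 t x) * (2 * inner (v t x) (H t x)) + cone_weight s R t x *
      (2 * inner (pd_x H t x) (v t x) + 2 * inner (pd_x v t x) (H t x)))"
  have A0: "A x \<noteq> 0" for x using A(2)[of x] by simp
  have cont_d: "continuous_on X (\<lambda>z. d (fst z) (snd z))" for X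
    unfolding d_def q1_def q2_def e_def by (intro cont subset_UNIV ballI A0)
  have dE: "(E has_real_derivative integral (cbox (-R) R) (d t)) (at t)" for t
  proof -
    have "((\<lambda>t. integral (cbox (-R) R) (\<lambda>x. cone_weight s R t x * e t x)) has_real_derivative
        integral (cbox (-R) R) (d t)) (at t within UNIV)"
    proof (rule leibniz_rule_field_derivative)
      show "((\<lambda>t. cone_weight s R t x * e t x) has_real_derivative d t x) (at t within UNIV)" for t x
        unfolding d_def using DERIV_mult[OF wt[of x t] et[of x t]] by (simp add: algebra_simps)
      show "(\<lambda>x. cone_weight s R t x * e t x) integrable_on cbox (- R) R" for t
        unfolding e_def by (intro integrable_continuous cont subset_UNIV ballI A0)
      show "continuous_on (UNIV \<times> cbox (- R) R) (\<lambda>(t, x). d t x)"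
        unfolding case_prod_beta' by (rule cont_d)
    qed auto
    then show ?thesis by (simp add: E_def e_def)
  qed
  have "integral (cbox (-R) R) (d t) \<le> 0" if t: "0 \<le> t" for t
  proof -
    have "(g t has_integral cone_weight s R t R * (2 * inner (v t R) (H t R))
        - cone_weight s R t (-R) * (2 * inner (v t (-R)) (H t (-R)))) {-R..R}"
    proof (rule fundamental_theorem_of_calculus)
      show "((\<lambda>x. cone_weight s R t x * (2 * inner (v t x) (H t x))) has_vector_derivative g t x)
          (at x within {-R..R})" for x
        using DERIV_mult[OF wx[of t x] fx[of t x]]
        unfolding g_def has_real_derivative_iff_has_vector_derivative
        by (simp add: algebra_simps has_vector_derivative_at_within)
    qed (use R in simp)
    \<comment> \<open>This is where t must be nonnegative: one factor has the argument
      \<open>- s * t\<close>.\<close>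
    moreover have "cone_weight s R t R = 0" "cone_weight s R t (-R) = 0"
      using s t by (simp_all add: cone_weight_def pos_sq_nonpos_arg)
    ultimately have g: "(g t has_integral 0) (cbox (-R) R)" by simp
    have "d t integrable_on cbox (-R) R"
      using continuous_on_compose2[OF cont_d[of UNIV] continuous_on_Pair[OF continuous_on_const continuous_on_id]]
      by (intro integrable_continuous) simp
    moreover have "d t x \<le> g t x" for x
    proof -
      have b: "\<bar>2 * inner (v t x) (H t x)\<bar> \<le> s * e t x"
        unfolding e_def by (intro power2_norm_scaled_le A s)
      have "- q2 t x * (2 * inner (v t x) (H t x)) \<le> q2 t x * (s * e t x)"
           "q1 t x * (2 * inner (v t x) (H t x)) \<le> q1 t x * (s * e t x)"
        using b q_nonneg[of t x] mult_left_mono[of "- (2 * inner (v t x) (H t x))" "s * e t x" "q2 t x"]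
        by (auto intro!: mult_left_mono)
      then show ?thesis by (simp add: d_def g_def algebra_simps)
    qed
    ultimately have "integral (cbox (-R) R) (d t) \<le> integral (cbox (-R) R) (g t)"
      using g by (intro integral_le) auto
    then show ?thesis using integral_unique[OF g] by simp
  qed
  with dE show ?thesis
    by (intro DERIV_nonpos_imp_nonincreasing[OF t]) blast
qed

section \<open>The flux is bounded by the initial data\<close>

lemma nth_vderiv_0 [simp]: "nth_vderiv 0 f = f"
  by (simp add: nth_vderiv_def)

lemma nth_vderiv_Suc: "nth_vderiv (Suc n) f = (\<lambda>x. vector_derivative (nth_vderiv n f) (at x))"
  by (simp add: nth_vderiv_def)

lemma Ck_on_antimono:
  assumes "Ck_on n f S" "m \<le> n"
  shows "Ck_on m f S"
proof (cases "m = n")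
  case False
  with assms have "\<forall>x\<in>S. nth_vderiv m f differentiable (at x)"
    by (simp add: Ck_on_def)
  then have "continuous_on S (nth_vderiv m f)"
    by (intro differentiable_imp_continuous_on) (simp add: differentiable_on_def differentiable_at_withinI)
  then show ?thesis using assms by (simp add: Ck_on_def)
qed (use assms in simp)

lemma Ck_on_has_vector_derivative:
  assumes "Ck_on n f S" "j < n" "x \<in> S"
  shows "(nth_vderiv j f has_vector_derivative nth_vderiv (Suc j) f x) (at x)"
  using assms vector_derivative_works by (auto simp: Ck_on_def nth_vderiv_Suc)

lemma continuous_on_DERIV_compose:
  assumes "\<And>x. (f has_real_derivative f' x) (at x)" "continuous_on S g"
  shows "continuous_on S (\<lambda>z. f (g z))"
proof -
  have "continuous_on UNIV f"
    using DERIV_isCont[OF assms(1)] by (simp add: continuous_at_imp_continuous_on)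
  from continuous_on_compose2[OF this assms(2)] show ?thesis by simp
qed

text \<open>The bridge from the Lebesgue integrals of the definitions to the gauge integral, for
  which the Leibniz rule and the fundamental theorem are applied.\<close>

lemma lborel_integral_eq_integral:
  fixes f :: "real \<Rightarrow> 'a::euclidean_space"
  assumes "continuous_on {a..b} f" "\<And>x. x \<notin> {a..b} \<Longrightarrow> f x = 0"
  shows "(\<integral>x. f x \<partial>lborel) = integral {a..b} f"
proof -
  have "(\<integral>x. f x \<partial>lborel) = (LINT x:{a..b}|lborel. f x)"
    unfolding set_lebesgue_integral_def using assms(2)
    by (intro Bochner_Integration.integral_cong) (auto simp: indicator_def)
  also have "\<dots> = integral {a..b} f"
    by (rule set_borel_integral_eq_integral(2)[OF borel_integrable_atLeastAtMost'[OF assms(1)]])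
  finally show ?thesis .
qed

lemma integrable_continuous_norm_sq:
  fixes f :: "real \<Rightarrow> 'a::real_normed_vector"
  shows "continuous_on {a..b} f \<Longrightarrow> (\<lambda>x. (norm (f x))\<^sup>2) integrable_on {a..b}"
  by (intro integrable_continuous_real continuous_intros)

section \<open>The rescaled coefficient and kernel\<close>

locale hmm_setting =
  fixes a K :: "real \<Rightarrow> real" and \<epsilon> \<eta> :: real
  assumes a_C1: "Ck_on 1 a UNIV"
    and a_periodic: "\<And>y. a (y + 1) = a y"
    and a_pos: "\<And>y. 0 < a y"
    and eps_pos: "0 < \<epsilon>" and eta_pos: "0 < \<eta>"
    and K_C1: "Ck_on 1 K UNIV"
    and K_supp: "\<And>x. 1 < \<bar>x\<bar> \<Longrightarrow> K x = 0"
begin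

definition A :: "real \<Rightarrow> real" where "A x = a (x / \<epsilon>)"

definition dA :: "real \<Rightarrow> real" where "dA x = nth_vderiv 1 a (x / \<epsilon>) / \<epsilon>"

definition \<kappa> :: "real \<Rightarrow> real" where "\<kappa> = scaled_kernel K \<eta>"

definition d\<kappa> :: "real \<Rightarrow> real" where "d\<kappa> x = nth_vderiv 1 K (x / \<eta>) / \<eta>\<^sup>2"

text \<open>Twice the width of the kernel, so that \<open>\<kappa>\<close> vanishes at the end points of \<open>[-L, L]\<close>.\<close>

definition L :: real where "L = 2 * \<eta>"

lemma L_pos: "0 < L" using eta_pos by (simp add: L_def)

lemma DERIV_a: "(a has_real_derivative nth_vderiv 1 a x) (at x)"
  using Ck_on_has_vector_derivative[OF a_C1, of 0 x]
  by (simp add: has_real_derivative_iff_has_vector_derivative)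

lemma DERIV_A: "(A has_real_derivative dA x) (at x)"
  unfolding A_def dA_def using DERIV_chain2[OF DERIV_a DERIV_cdivide[OF DERIV_ident]] by simp

lemma continuous_on_A: "continuous_on S f \<Longrightarrow> continuous_on S (\<lambda>z. A (f z))"
  by (rule continuous_on_DERIV_compose[OF DERIV_A])

lemma A_pos: "0 < A x"
  by (simp add: A_def a_pos)

lemma DERIV_kappa: "(\<kappa> has_real_derivative d\<kappa> x) (at x)"
proof -
  have "(K has_real_derivative nth_vderiv 1 K x) (at x)" for x
    using Ck_on_has_vector_derivative[OF K_C1, of 0 x]
    by (simp add: has_real_derivative_iff_has_vector_derivative)
  from DERIV_cdivide[OF DERIV_chain2[OF this DERIV_cdivide[OF DERIV_ident]]] show ?thesis
    unfolding \<kappa>_def scaled_kernel_def d\<kappa>_def by (simp add: power2_eq_square)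
qed

lemma continuous_on_kappa: "continuous_on S f \<Longrightarrow> continuous_on S (\<lambda>z. \<kappa> (f z))"
  by (rule continuous_on_DERIV_compose[OF DERIV_kappa])

lemma continuous_on_dkappa: "continuous_on S f \<Longrightarrow> continuous_on S (\<lambda>z. d\<kappa> (f z))"
proof -
  assume f: "continuous_on S f"
  have "continuous_on UNIV (nth_vderiv 1 K)"
    using K_C1 by (simp add: Ck_on_def)
  from continuous_on_compose2[OF this continuous_on_divide[OF f continuous_on_const]] show ?thesis
    unfolding d\<kappa>_def using eta_pos by (intro continuous_intros) auto
qed

lemma kappa_outside: "L \<le> \<bar>x\<bar> \<Longrightarrow> \<kappa> x = 0"
  using eta_pos by (auto simp: \<kappa>_def scaled_kernel_def L_def intro!: K_supp)

lemmas setting_continuous_intros = continuous_on_A continuous_on_kappa continuous_on_dkappa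

lemma a_shift_nat: "a (y + real n) = a y"
proof (induction n)
  case (Suc n)
  show ?case using a_periodic[of "y + real n"] Suc by (simp add: algebra_simps)
qed simp

lemma a_frac: "a y = a (frac y)"
proof (cases "0 \<le> \<lfloor>y\<rfloor>")
  case True
  then show ?thesis using a_shift_nat[of "frac y" "nat \<lfloor>y\<rfloor>"] by (simp add: frac_def)
next
  case False
  then show ?thesis using a_shift_nat[of y "nat (- \<lfloor>y\<rfloor>)"] by (simp add: frac_def)
qed

text \<open>Periodicity reduces the bound to the compact cell [0, 1]. The square root of the bound
  dominates every local wave speed.\<close>

lemma wave_speed: obtains s where "0 < s" "\<And>x. A x \<le> s\<^sup>2"
proof -
  have "continuous_on {0..1} a"
    using DERIV_a DERIV_isCont continuous_at_imp_continuous_on by blast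
  then have "bounded (a ` {0..1})"
    by (intro compact_imp_bounded compact_continuous_image) auto
  then obtain B where B: "0 < B" "\<And>y. y \<in> {0..1} \<Longrightarrow> \<bar>a y\<bar> \<le> B"
    unfolding bounded_pos by auto
  have "A x \<le> (sqrt B)\<^sup>2" for x
  proof -
    have "frac (x / \<epsilon>) \<in> {0..1}" using frac_lt_1[of "x / \<epsilon>"] by (simp add: less_imp_le)
    from B(2)[OF this] have "a (frac (x / \<epsilon>)) \<le> B" by simp
    then show ?thesis using a_frac[of "x / \<epsilon>"] B(1) by (simp add: A_def)
  qed
  then show thesis using that[of "sqrt B"] B(1) by simp
qed

text \<open>\<open>pd_x\<close> is an unspecified value where no derivative exists. Since
  \<open>a\<close> and \<open>pd_x v\<close> are differentiable, the right-hand side of the wave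
  equation is a true derivative.\<close>

lemma C1_plane_flux_derivative:
  assumes "C1_plane (pd_x v)"
  shows "((\<lambda>y. A y *\<^sub>R pd_x v t y) has_vector_derivative
    pd_x (\<lambda>t x. of_real (a (x / \<epsilon>)) * pd_x v t x) t x) (at x)"
proof -
  have "((\<lambda>y. A y *\<^sub>R pd_x v t y) has_vector_derivative
      A x *\<^sub>R pd_x (pd_x v) t x + dA x *\<^sub>R pd_x v t x) (at x)"
    using C1_plane_pd_x[OF assms, of t x UNIV] DERIV_A[of x] by (auto intro!: derivative_eq_intros)
  then show ?thesis
    unfolding pd_x_def[of "\<lambda>t x. of_real (a (x / \<epsilon>)) * pd_x v t x"]
    using differentiableI_vector vector_derivative_works
    by (fastforce simp: A_def scaleR_conv_of_real)
qed

lemma wave_solution_C1_plane: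
  assumes "wave_solution a \<epsilon> Q v"
  shows "C1_plane v" "C1_plane (pd_t v)" "C1_plane (pd_x v)"
  using assms by (auto simp: wave_solution_def C2_plane_def)

lemma wave_solution_flux_derivative:
  assumes "wave_solution a \<epsilon> Q v"
  shows "((\<lambda>y. A y *\<^sub>R pd_x v t y) has_vector_derivative pd_t (pd_t v) t x) (at x)"
  using C1_plane_flux_derivative[OF wave_solution_C1_plane(3)[OF assms], of t x] assms
  by (simp add: wave_solution_def)

lemma wave_solutionI:
  assumes "C1_plane v" "C1_plane (pd_t v)" "C1_plane (pd_x v)"
    and "\<And>t x. ((\<lambda>y. A y *\<^sub>R pd_x v t y) has_vector_derivative pd_t (pd_t v) t x) (at x)"
    and "\<And>x. v 0 x = Q x" "\<And>x. pd_t v 0 x = 0"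
  shows "wave_solution a \<epsilon> Q v"
  using assms vector_derivative_unique_at[OF assms(4) C1_plane_flux_derivative[OF assms(3)]]
  by (simp add: wave_solution_def C2_plane_def)

text \<open>The wave equation as the first order system \<open>\<partial>\<^sub>t v = \<partial>\<^sub>x H\<close>, \<open>\<partial>\<^sub>t H = A \<partial>\<^sub>x v\<close>. Since
  \<open>H(0, \<cdot>) = 0\<close>, its energy at time \<open>0\<close> involves \<open>Q\<close> but not \<open>Q'\<close>.\<close>

lemma wave_solution_first_order:
  assumes sol: "wave_solution a \<epsilon> Q v"
  obtains H where "C1_plane v" "C1_plane H" "\<And>t x. pd_t v t x = pd_x H t x"
    "\<And>t x. pd_t H t x = A x *\<^sub>R pd_x v t x" "\<And>x. H 0 x = 0" "\<And>x. v 0 x = Q x"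
proof -
  note v = wave_solution_C1_plane[OF sol]
  have init: "\<And>x. v 0 x = Q x" "\<And>x. pd_t v 0 x = 0"
    using sol by (auto simp: wave_solution_def)
  define f where "f = (\<lambda>t x. A x *\<^sub>R pd_x v t x)"
  have cf: "continuous_on UNIV (\<lambda>(t, x). f t x)"
    unfolding f_def case_prod_beta'
    by (intro C1_plane_continuous_intros[OF v(1)] setting_continuous_intros continuous_intros)
  have fx: "((\<lambda>y. f t y) has_vector_derivative pd_t (pd_t v) t x) (at x)" for t x
    unfolding f_def by (rule wave_solution_flux_derivative[OF sol])
  \<comment> \<open>The zero initial velocity makes the x-derivative of \<open>H\<close> equal to
    \<open>pd_t v\<close> without a remainder.\<close>
  note H = C1_plane_time_integral[OF cf v(2) init(2) fx]
  show thesis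
  proof (rule that[OF v(1) H(1)])
    show "pd_t v t x = pd_x (time_integral f) t x" for t x
      by (simp add: H(3))
    show "pd_t (time_integral f) t x = A x *\<^sub>R pd_x v t x" for t x
      unfolding H(2) by (simp add: f_def)
  qed (simp_all add: init time_integral_def)
qed

lemma hmm_flux_eq_integral:
  assumes v: "C1_plane v"
  shows "hmm_flux a K \<epsilon> \<eta> v =
    integral {-L..L} (\<lambda>t. \<kappa> t *\<^sub>R integral {-L..L} (\<lambda>x. \<kappa> x *\<^sub>R A x *\<^sub>R pd_x v t x))"
proof -
  have inner: "(\<integral>x. of_real (scaled_kernel K \<eta> x * scaled_kernel K \<eta> t * a (x / \<epsilon>)) * pd_x v t x \<partial>lborel)
      = \<kappa> t *\<^sub>R integral {-L..L} (\<lambda>x. \<kappa> x *\<^sub>R A x *\<^sub>R pd_x v t x)" for t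
  proof -
    have "(\<integral>x. of_real (scaled_kernel K \<eta> x * scaled_kernel K \<eta> t * a (x / \<epsilon>)) * pd_x v t x \<partial>lborel)
      = (\<integral>x. \<kappa> t *\<^sub>R \<kappa> x *\<^sub>R A x *\<^sub>R pd_x v t x \<partial>lborel)"
      by (simp add: \<kappa>_def A_def scaleR_conv_of_real mult_ac)
    also have "\<dots> = integral {-L..L} (\<lambda>x. \<kappa> t *\<^sub>R \<kappa> x *\<^sub>R A x *\<^sub>R pd_x v t x)"
    proof (rule lborel_integral_eq_integral)
      show "\<kappa> t *\<^sub>R \<kappa> x *\<^sub>R A x *\<^sub>R pd_x v t x = 0" if "x \<notin> {-L..L}" for x
      proof -
        have "\<kappa> x = 0" by (rule kappa_outside) (use that in auto)
        then show ?thesis by simp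
      qed
    qed (intro C1_plane_continuous_intros[OF v] setting_continuous_intros continuous_intros)
    also have "\<dots> = \<kappa> t *\<^sub>R integral {-L..L} (\<lambda>x. \<kappa> x *\<^sub>R A x *\<^sub>R pd_x v t x)"
      by (rule integral_cmul)
    finally show ?thesis .
  qed
  have "continuous_on {-L..L} (\<lambda>t. integral (cbox (-L) L) (\<lambda>x. \<kappa> x *\<^sub>R A x *\<^sub>R pd_x v t x))"
    by (rule integral_continuous_on_param) (unfold case_prod_beta',
      intro C1_plane_continuous_intros[OF v] setting_continuous_intros continuous_intros)
  then show ?thesis
    unfolding hmm_flux_def inner
    by (intro lborel_integral_eq_integral)
      (auto intro!: continuous_intros setting_continuous_intros kappa_outside)
qed

text \<open>The integrand is \<kappa>(t) times the t-derivative of the x-average of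
  \<open>H\<close>. The boundary terms vanish because \<kappa> is 0 at L and -L, and no derivative
  of the solution is left.\<close>

lemma hmm_flux_by_parts:
  assumes v: "C1_plane v" and H: "C1_plane H"
    and Ht: "\<And>t x. pd_t H t x = A x *\<^sub>R pd_x v t x"
  shows "hmm_flux a K \<epsilon> \<eta> v =
    - integral {-L..L} (\<lambda>t. d\<kappa> t *\<^sub>R integral {-L..L} (\<lambda>x. \<kappa> x *\<^sub>R H t x))"
proof -
  note cont = C1_plane_continuous_intros[OF v] C1_plane_continuous_intros[OF H] setting_continuous_intros continuous_intros
  define h where "h = (\<lambda>t. integral {-L..L} (\<lambda>x. \<kappa> x *\<^sub>R H t x))"
  define h' where "h' = (\<lambda>t. integral {-L..L} (\<lambda>x. \<kappa> x *\<^sub>R pd_t H t x))"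
  have h: "(h has_vector_derivative h' t) (at t)" for t
  proof -
    have "((\<lambda>t. integral (cbox (-L) L) (\<lambda>x. \<kappa> x *\<^sub>R H t x)) has_vector_derivative
        integral (cbox (-L) L) (\<lambda>x. \<kappa> x *\<^sub>R pd_t H t x)) (at t within UNIV)"
    proof (rule leibniz_rule_vector_derivative)
      show "((\<lambda>t. \<kappa> x *\<^sub>R H t x) has_vector_derivative \<kappa> x *\<^sub>R pd_t H t x) (at t within UNIV)" for t x
        by (auto intro!: derivative_eq_intros C1_plane_pd_t[OF H])
      show "continuous_on (UNIV \<times> cbox (- L) L) (\<lambda>(t, x). \<kappa> x *\<^sub>R pd_t H t x)"
        unfolding case_prod_beta' by (intro cont)
      show "(\<lambda>x. \<kappa> x *\<^sub>R H t x) integrable_on cbox (- L) L" for t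
        by (intro integrable_continuous cont)
    qed auto
    then show ?thesis by (simp add: h_def h'_def)
  qed
  have "((\<lambda>t. d\<kappa> t *\<^sub>R h t + \<kappa> t *\<^sub>R h' t) has_integral \<kappa> L *\<^sub>R h L - \<kappa> (-L) *\<^sub>R h (-L)) {-L..L}"
  proof (rule fundamental_theorem_of_calculus)
    show "((\<lambda>t. \<kappa> t *\<^sub>R h t) has_vector_derivative d\<kappa> t *\<^sub>R h t + \<kappa> t *\<^sub>R h' t) (at t within {-L..L})" for t
      by (rule has_vector_derivative_at_within)
        (auto intro!: derivative_eq_intros DERIV_kappa h simp: algebra_simps)
  qed (use L_pos in simp)
  then have 1: "integral {-L..L} (\<lambda>t. d\<kappa> t *\<^sub>R h t + \<kappa> t *\<^sub>R h' t) = 0"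
    by (simp add: integral_unique kappa_outside)
  have "continuous_on {-L..L} h"
    by (rule continuous_on_has_vector_derivative[OF h])
  then have i1: "(\<lambda>t. d\<kappa> t *\<^sub>R h t) integrable_on {-L..L}"
    by (intro integrable_continuous_real cont)
  have "continuous_on {-L..L} (\<lambda>t. integral (cbox (-L) L) (\<lambda>x. \<kappa> x *\<^sub>R pd_t H t x))"
    by (rule integral_continuous_on_param) (unfold case_prod_beta', intro cont)
  then have i2: "(\<lambda>t. \<kappa> t *\<^sub>R h' t) integrable_on {-L..L}"
    unfolding h'_def by (intro integrable_continuous_real cont) simp
  have "integral {-L..L} (\<lambda>t. d\<kappa> t *\<^sub>R h t) + integral {-L..L} (\<lambda>t. \<kappa> t *\<^sub>R h' t) = 0"
    using 1 Henstock_Kurzweil_Integration.integral_add[OF i1 i2] by simp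
  then show ?thesis
    unfolding hmm_flux_eq_integral[OF v] h_def h'_def Ht by (simp add: eq_neg_iff_add_eq_0 add.commute)
qed

text \<open>The cone of slope \<open>s\<close> over [-R, R] still covers [-L, L] with margin 1 at
  time \<open>L\<close>, which fixes \<open>R\<close>. The factor \<open>s\<^sup>2\<close> comes
  from dividing by \<open>A\<close> in the energy, the factor \<open>(2 * R) ^ 4\<close> from the
  weight at time 0, when \<open>H\<close> vanishes.\<close>

lemma energy_bound:
  assumes v: "C1_plane v" and H: "C1_plane H"
    and vt: "\<And>t x. pd_t v t x = pd_x H t x"
    and Ht: "\<And>t x. pd_t H t x = A x *\<^sub>R pd_x v t x"
    and H0: "\<And>x. H 0 x = 0"
    and s: "0 < s" "\<And>x. A x \<le> s\<^sup>2" and t: "0 \<le> t" "t \<le> L" and R: "R = s * L + L + 1"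
  shows "integral {-L..L} (\<lambda>x. (norm (H t x))\<^sup>2)
    \<le> s\<^sup>2 * (2 * R) ^ 4 * integral {-R..R} (\<lambda>x. (norm (v 0 x))\<^sup>2)"
proof -
  note cont = C1_plane_continuous_intros[OF v] C1_plane_continuous_intros[OF H] setting_continuous_intros
    continuous_on_cone_weight continuous_intros
  define e where "e = (\<lambda>t x. inner (v t x) (v t x) + inner (H t x) (H t x) / A x)"
  have A0: "A x \<noteq> 0" for x using A_pos[of x] by simp
  have e_nonneg: "0 \<le> e t x" for t x
    using A_pos[of x] by (simp add: e_def)
  have int: "(\<lambda>x. cone_weight s R t x * e t x) integrable_on {c..d}" for c d t
    unfolding e_def by (intro integrable_continuous_real cont ballI A0)
  have LR: "L \<le> R" "0 \<le> R" using R s(1) L_pos by auto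
  have "integral {-L..L} (\<lambda>x. (norm (H t x))\<^sup>2)
      \<le> integral {-L..L} (\<lambda>x. s\<^sup>2 * (cone_weight s R t x * e t x))"
  proof (rule integral_le)
    fix x assume x: "x \<in> {-L..L}"
    have "(norm (H t x))\<^sup>2 = A x * (inner (H t x) (H t x) / A x)"
      using A0[of x] by (simp add: power2_norm_eq_inner)
    also have "\<dots> \<le> s\<^sup>2 * (inner (H t x) (H t x) / A x)"
      using s(2)[of x] A_pos[of x] by (intro mult_right_mono) auto
    also have "\<dots> \<le> s\<^sup>2 * e t x"
      by (intro mult_left_mono) (auto simp: e_def)
    also have "\<dots> \<le> s\<^sup>2 * (cone_weight s R t x * e t x)"
    proof (rule mult_left_mono)
      have "s * t \<le> s * L" using s t by simp
      then have "1 \<le> cone_weight s R t x"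
        using x R by (intro cone_weight_ge_1) auto
      from mult_right_mono[OF this e_nonneg[of t x]]
      show "e t x \<le> cone_weight s R t x * e t x" by simp
    qed simp
    finally show "(norm (H t x))\<^sup>2 \<le> s\<^sup>2 * (cone_weight s R t x * e t x)" .
  next
    show "(\<lambda>x. s\<^sup>2 * (cone_weight s R t x * e t x)) integrable_on {-L..L}"
      unfolding e_def by (intro integrable_continuous_real cont ballI A0)
  qed (intro integrable_continuous_norm_sq cont)
  also have "\<dots> = s\<^sup>2 * integral {-L..L} (\<lambda>x. cone_weight s R t x * e t x)"
    by simp
  also have "\<dots> \<le> s\<^sup>2 * integral {-R..R} (\<lambda>x. cone_weight s R t x * e t x)"
    using LR int e_nonneg cone_weight_nonneg
    by (intro mult_left_mono integral_subset_le) auto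
  also have "\<dots> \<le> s\<^sup>2 * integral {-R..R} (\<lambda>x. cone_weight s R 0 x * e 0 x)"
    unfolding e_def
    using weighted_energy_nonincreasing[OF v H vt Ht continuous_on_A[OF continuous_on_id] A_pos s(2,1) t(1)]
    by (intro mult_left_mono) auto
  also have "\<dots> \<le> s\<^sup>2 * integral {-R..R} (\<lambda>x. (2 * R) ^ 4 * (norm (v 0 x))\<^sup>2)"
  proof (intro mult_left_mono integral_le)
    show "cone_weight s R 0 x * e 0 x \<le> (2 * R) ^ 4 * (norm (v 0 x))\<^sup>2" if "x \<in> {-R..R}" for x
      using cone_weight_0_le[of x R s] that
      by (auto simp: e_def H0 power2_norm_eq_inner intro!: mult_right_mono)
  qed (use int in \<open>auto intro!: integrable_continuous_real cont\<close>)
  finally show ?thesis by (simp add: mult.assoc)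
qed

text \<open>\<open>R\<close> and \<open>C\<close> are chosen before the data. An upper bound
  \<sigma> > 0 in place of the norm avoids square roots and division by zero when Young's inequality
  with a parameter proportional to \<sigma> does the work of Cauchy-Schwarz.\<close>

lemma hmm_flux_bound:
  obtains R C where "0 < R" "0 < C"
    "\<And>Q v \<sigma>. wave_solution a \<epsilon> Q v \<Longrightarrow> 0 < \<sigma> \<Longrightarrow>
      integral {-R..R} (\<lambda>x. (norm (Q x))\<^sup>2) \<le> \<sigma>\<^sup>2 \<Longrightarrow> norm (hmm_flux a K \<epsilon> \<eta> v) \<le> C * \<sigma>"
proof -
  obtain s where s: "0 < s" "\<And>x. A x \<le> s\<^sup>2" using wave_speed by blast
  define R where "R = s * L + L + 1"
  have R: "0 < R" using s(1) L_pos by (simp add: R_def add_pos_pos)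
  have bdd: "\<exists>B>0. \<forall>x\<in>{-L..L}. \<bar>f x\<bar> \<le> B" if "continuous_on {-L..L} f" for f :: "real \<Rightarrow> real"
  proof -
    have "bounded (f ` {-L..L})"
      by (intro compact_imp_bounded compact_continuous_image that) auto
    then show ?thesis unfolding bounded_pos by auto
  qed
  obtain M where M: "0 < M" "\<And>x. x \<in> {-L..L} \<Longrightarrow> \<bar>\<kappa> x\<bar> \<le> M"
    using bdd[OF continuous_on_kappa[OF continuous_on_id]] by auto
  obtain M' where M': "0 < M'" "\<And>x. x \<in> {-L..L} \<Longrightarrow> \<bar>d\<kappa> x\<bar> \<le> M'"
    using bdd[OF continuous_on_dkappa[OF continuous_on_id]] by auto
  \<comment> \<open>The square root of the constant in \<open>energy_bound\<close>.\<close>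
  define c where "c = s * (2 * R)\<^sup>2"
  have c: "0 < c" using s(1) R by (simp add: c_def)
  \<comment> \<open>The sum of the two Young terms with parameter \<open>r = c * \<sigma>\<close>:
    \<open>M * r * L\<close> from the constant, \<open>M * r / 2\<close> from the energy.\<close>
  define D where "D = M * c * (2 * L + 1) / 2"
  have D: "0 < D" using M(1) c L_pos by (simp add: D_def add_pos_pos)
  have "norm (hmm_flux a K \<epsilon> \<eta> v) \<le> (M' * D * (2 * L)) * \<sigma>"
    if sol: "wave_solution a \<epsilon> Q v" and sg: "0 < \<sigma>"
      and Q: "integral {-R..R} (\<lambda>x. (norm (Q x))\<^sup>2) \<le> \<sigma>\<^sup>2" for Q v \<sigma>
  proof -
    obtain H where v: "C1_plane v" and H: "C1_plane H"
      and vt: "\<And>t x. pd_t v t x = pd_x H t x"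
      and Ht: "\<And>t x. pd_t H t x = A x *\<^sub>R pd_x v t x"
      and H0: "\<And>x. H 0 x = 0" and v0: "\<And>x. v 0 x = Q x"
      using wave_solution_first_order[OF sol] by blast
    note cont = C1_plane_continuous_intros[OF v] C1_plane_continuous_intros[OF H] setting_continuous_intros continuous_intros
    have en_all: "s\<^sup>2 * (2 * R) ^ 4 * integral {-R..R} (\<lambda>x. (norm (v 0 x))\<^sup>2) \<le> (c * \<sigma>)\<^sup>2"
      using mult_left_mono[OF Q, of "s\<^sup>2 * (2 * R) ^ 4"]
      by (simp add: v0 c_def power_mult_distrib flip: power_mult)
    have en: "integral {-L..L} (\<lambda>x. (norm (H t x))\<^sup>2) \<le> (c * \<sigma>)\<^sup>2" if t: "t \<in> {-L..L}" for t
    proof (cases "0 \<le> t")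
      case True
      have "integral {-L..L} (\<lambda>x. (norm (H t x))\<^sup>2)
          \<le> s\<^sup>2 * (2 * R) ^ 4 * integral {-R..R} (\<lambda>x. (norm (v 0 x))\<^sup>2)"
        using t by (intro energy_bound[OF v H vt Ht H0 s True _ R_def]) auto
      then show ?thesis using en_all by linarith
    next
      case False
      \<comment> \<open>Time reversal. The minus sign in \<open>H'\<close> preserves both equations
        of the system, so the forward estimate covers negative times.\<close>
      define v' where "v' = (\<lambda>t x. v (- t) x)"
      define H' where "H' = (\<lambda>t x. - H (- t) x)"
      have rev: "((\<lambda>t. u (- t) x) has_vector_derivative - pd_t u (- t) x) (at t)"
        if "C1_plane u" for u t x
      proof -
        have "(uminus has_vector_derivative - 1) (at t)"
          by (auto intro!: derivative_eq_intros)
        from vector_diff_chain_at[OF this C1_plane_pd_t[OF that]] show ?thesis by (simp add: o_def)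
      qed
      have v'1: "((\<lambda>t. v' t x) has_vector_derivative - pd_t v (- t) x) (at t)"
        and v'2: "((\<lambda>x. v' t x) has_vector_derivative pd_x v (- t) x) (at x)"
        and H'1: "((\<lambda>t. H' t x) has_vector_derivative pd_t H (- t) x) (at t)"
        and H'2: "((\<lambda>x. H' t x) has_vector_derivative - pd_x H (- t) x) (at x)" for t x
        unfolding v'_def H'_def using rev[OF v] rev[OF H] C1_plane_pd_x[OF v] C1_plane_pd_x[OF H]
        by (auto intro!: derivative_eq_intros)
      have v': "C1_plane v'" "pd_t v' = (\<lambda>t x. - pd_t v (- t) x)" "pd_x v' = (\<lambda>t x. pd_x v (- t) x)"
        by (rule C1_planeI[OF v'1 v'2]; unfold case_prod_beta', intro cont)+
      have H': "C1_plane H'" "pd_t H' = (\<lambda>t x. pd_t H (- t) x)" "pd_x H' = (\<lambda>t x. - pd_x H (- t) x)"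
        by (rule C1_planeI[OF H'1 H'2]; unfold case_prod_beta', intro cont)+
      have "integral {-L..L} (\<lambda>x. (norm (H' (-t) x))\<^sup>2)
          \<le> s\<^sup>2 * (2 * R) ^ 4 * integral {-R..R} (\<lambda>x. (norm (v' 0 x))\<^sup>2)"
        by (rule energy_bound[OF v'(1) H'(1) _ _ _ s _ _ R_def])
          (use False t in \<open>auto simp: v'(2,3) H'(2,3) vt Ht, auto simp: H'_def H0\<close>)
      then show ?thesis using en_all by (simp add: v'_def H'_def)
    qed
    have h: "norm (integral {-L..L} (\<lambda>x. \<kappa> x *\<^sub>R H t x)) \<le> D * \<sigma>" if t: "t \<in> {-L..L}" for t
    proof -
      define r where "r = c * \<sigma>"
      have r: "0 < r" using c sg by (simp add: r_def)
      have iH: "(\<lambda>x. (norm (H t x))\<^sup>2) integrable_on {-L..L}"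
        by (intro integrable_continuous_norm_sq cont)
      have "norm (integral {-L..L} (\<lambda>x. \<kappa> x *\<^sub>R H t x))
          \<le> integral {-L..L} (\<lambda>x. M * r / 2 + M / (2 * r) * (norm (H t x))\<^sup>2)"
      proof (rule integral_norm_bound_integral)
        fix x assume x: "x \<in> {-L..L}"
        have "norm (\<kappa> x *\<^sub>R H t x) \<le> M * norm (H t x)"
          using M(2)[OF x] by (auto intro!: mult_right_mono)
        also have "\<dots> \<le> M * (r / 2 + (norm (H t x))\<^sup>2 / (2 * r))"
        proof (rule mult_left_mono)
          have "0 \<le> (r - norm (H t x))\<^sup>2 / (2 * r)" using r by simp
          also have "\<dots> = r / 2 + (norm (H t x))\<^sup>2 / (2 * r) - norm (H t x)"
            using r by (simp add: field_simps power2_eq_square)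
          finally show "norm (H t x) \<le> r / 2 + (norm (H t x))\<^sup>2 / (2 * r)" by simp
        qed (use M in simp)
        finally show "norm (\<kappa> x *\<^sub>R H t x) \<le> M * r / 2 + M / (2 * r) * (norm (H t x))\<^sup>2"
          by (simp add: algebra_simps)
      qed (use iH r in \<open>auto intro!: integrable_continuous_real cont\<close>)
      also have "\<dots> = integral {-L..L} (\<lambda>x. M * r / 2)
          + integral {-L..L} (\<lambda>x. M / (2 * r) * (norm (H t x))\<^sup>2)"
        by (intro Henstock_Kurzweil_Integration.integral_add integrable_continuous_real cont)
      also have "\<dots> = M * r / 2 * (2 * L) + M / (2 * r) * integral {-L..L} (\<lambda>x. (norm (H t x))\<^sup>2)"
        using L_pos by simp
      also have "\<dots> \<le> M * r / 2 * (2 * L) + M / (2 * r) * r\<^sup>2"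
        using en[OF t] M(1) r by (intro add_left_mono mult_left_mono) (auto simp: r_def)
      also have "\<dots> = D * \<sigma>"
        using r sg c by (simp add: D_def r_def field_simps power2_eq_square)
      finally show ?thesis .
    qed
    have "continuous_on {-L..L} (\<lambda>t. integral (cbox (-L) L) (\<lambda>x. \<kappa> x *\<^sub>R H t x))"
      by (rule integral_continuous_on_param) (unfold case_prod_beta', intro cont)
    then have ih: "(\<lambda>t. d\<kappa> t *\<^sub>R integral {-L..L} (\<lambda>x. \<kappa> x *\<^sub>R H t x)) integrable_on {-L..L}"
      by (intro integrable_continuous_real cont) simp
    have "norm (hmm_flux a K \<epsilon> \<eta> v)
        = norm (integral {-L..L} (\<lambda>t. d\<kappa> t *\<^sub>R integral {-L..L} (\<lambda>x. \<kappa> x *\<^sub>R H t x)))"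
      by (simp add: hmm_flux_by_parts[OF v H Ht])
    also have "\<dots> \<le> integral {-L..L} (\<lambda>t. M' * (D * \<sigma>))"
    proof (rule integral_norm_bound_integral[OF ih])
      show "norm (d\<kappa> t *\<^sub>R integral {-L..L} (\<lambda>x. \<kappa> x *\<^sub>R H t x)) \<le> M' * (D * \<sigma>)"
        if "t \<in> {-L..L}" for t
        using M'(2)[OF that] h[OF that] M'(1) unfolding norm_scaleR by (intro mult_mono) auto
    qed auto
    also have "\<dots> = (M' * D * (2 * L)) * \<sigma>"
      using L_pos by simp
    finally show ?thesis .
  qed
  then show thesis
    using that[of R "M' * D * (2 * L)"] R M'(1) D L_pos by simp
qed

end

section \<open>The flux as a closed linear relation on initial data\<close>

lemma C1_plane_lincomb:
  assumes v: "C1_plane v" and w: "C1_plane w"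
  shows "C1_plane (\<lambda>t x. c * v t x + d * w t x)"
    and "pd_t (\<lambda>t x. c * v t x + d * w t x) = (\<lambda>t x. c * pd_t v t x + d * pd_t w t x)"
    and "pd_x (\<lambda>t x. c * v t x + d * w t x) = (\<lambda>t x. c * pd_x v t x + d * pd_x w t x)"
proof -
  note cont = C1_plane_continuous_intros[OF v] C1_plane_continuous_intros[OF w] continuous_intros
  have 1: "((\<lambda>t. c * v t x + d * w t x) has_vector_derivative c * pd_t v t x + d * pd_t w t x) (at t)"
    for t x
    by (intro has_vector_derivative_add has_vector_derivative_mult_right C1_plane_pd_t v w)
  have 2: "((\<lambda>x. c * v t x + d * w t x) has_vector_derivative c * pd_x v t x + d * pd_x w t x) (at x)"
    for t x
    by (intro has_vector_derivative_add has_vector_derivative_mult_right C1_plane_pd_x v w)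
  have ct: "continuous_on UNIV (\<lambda>(t, x). c * pd_t v t x + d * pd_t w t x)"
    unfolding case_prod_beta' by (intro cont)
  have cx: "continuous_on UNIV (\<lambda>(t, x). c * pd_x v t x + d * pd_x w t x)"
    unfolding case_prod_beta' by (intro cont)
  show "C1_plane (\<lambda>t x. c * v t x + d * w t x)"
    "pd_t (\<lambda>t x. c * v t x + d * w t x) = (\<lambda>t x. c * pd_t v t x + d * pd_t w t x)"
    "pd_x (\<lambda>t x. c * v t x + d * w t x) = (\<lambda>t x. c * pd_x v t x + d * pd_x w t x)"
    using C1_planeI[OF 1 2 ct cx] by auto
qed

lemma integral_lincomb:
  fixes f g :: "real \<Rightarrow> complex"
  assumes "f integrable_on S" "g integrable_on S"
  shows "integral S (\<lambda>x. c * f x + d * g x) = c * integral S f + d * integral S g"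
  using Henstock_Kurzweil_Integration.integral_add[OF
      integrable_on_mult_right[OF assms(1), of c] integrable_on_mult_right[OF assms(2), of d]]
  by simp

context hmm_setting
begin

lemma wave_solution_lincomb:
  assumes v: "wave_solution a \<epsilon> P v" and w: "wave_solution a \<epsilon> Q w"
  shows "wave_solution a \<epsilon> (\<lambda>x. c * P x + d * Q x) (\<lambda>t x. c * v t x + d * w t x)"
proof -
  note v1 = wave_solution_C1_plane[OF v] and w1 = wave_solution_C1_plane[OF w]
  note comb = C1_plane_lincomb[OF v1(1) w1(1)] C1_plane_lincomb[OF v1(2) w1(2)]
    C1_plane_lincomb[OF v1(3) w1(3)]
  show ?thesis
  proof (rule wave_solutionI)
    fix t x
    have "((\<lambda>y. c * (A y *\<^sub>R pd_x v t y) + d * (A y *\<^sub>R pd_x w t y)) has_vector_derivative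
        c * pd_t (pd_t v) t x + d * pd_t (pd_t w) t x) (at x)"
      by (intro has_vector_derivative_add has_vector_derivative_mult_right
          wave_solution_flux_derivative[OF v] wave_solution_flux_derivative[OF w])
    then show "((\<lambda>y. A y *\<^sub>R pd_x (\<lambda>t x. c * v t x + d * w t x) t y) has_vector_derivative
        pd_t (pd_t (\<lambda>t x. c * v t x + d * w t x)) t x) (at x)"
      by (simp add: comb scaleR_add_right)
  qed (use v w in \<open>simp_all add: comb wave_solution_def\<close>)
qed

lemma hmm_flux_lincomb:
  assumes v: "C1_plane v" and w: "C1_plane w"
  shows "hmm_flux a K \<epsilon> \<eta> (\<lambda>t x. c * v t x + d * w t x)
    = c * hmm_flux a K \<epsilon> \<eta> v + d * hmm_flux a K \<epsilon> \<eta> w"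
proof -
  note comb = C1_plane_lincomb[OF v w]
  define J where "J = (\<lambda>u t. integral {-L..L} (\<lambda>x. \<kappa> x *\<^sub>R A x *\<^sub>R pd_x u t x))"
  have int: "(\<lambda>x. \<kappa> x *\<^sub>R A x *\<^sub>R pd_x u t x) integrable_on {-L..L}" if "C1_plane u" for u t
    by (intro integrable_continuous_real C1_plane_continuous_intros[OF that]
        setting_continuous_intros continuous_intros)
  have J: "J (\<lambda>t x. c * v t x + d * w t x) t = c * J v t + d * J w t" for t
  proof -
    have "J (\<lambda>t x. c * v t x + d * w t x) t = integral {-L..L}
        (\<lambda>x. c * (\<kappa> x *\<^sub>R A x *\<^sub>R pd_x v t x) + d * (\<kappa> x *\<^sub>R A x *\<^sub>R pd_x w t x))"
      by (simp add: J_def comb scaleR_add_right)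
    also have "\<dots> = c * J v t + d * J w t"
      unfolding J_def by (intro integral_lincomb int v w)
    finally show ?thesis .
  qed
  have intJ: "(\<lambda>t. \<kappa> t *\<^sub>R J u t) integrable_on {-L..L}" if u: "C1_plane u" for u
  proof -
    have "continuous_on {-L..L} (\<lambda>t. integral (cbox (-L) L) (\<lambda>x. \<kappa> x *\<^sub>R A x *\<^sub>R pd_x u t x))"
      by (rule integral_continuous_on_param) (unfold case_prod_beta',
        intro C1_plane_continuous_intros[OF u] setting_continuous_intros continuous_intros)
    then show ?thesis
      unfolding J_def by (intro integrable_continuous_real continuous_intros setting_continuous_intros) simp
  qed
  have "hmm_flux a K \<epsilon> \<eta> (\<lambda>t x. c * v t x + d * w t x)
      = integral {-L..L} (\<lambda>t. c * (\<kappa> t *\<^sub>R J v t) + d * (\<kappa> t *\<^sub>R J w t))"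
    unfolding hmm_flux_eq_integral[OF comb(1)] J[unfolded J_def]
    by (simp add: J_def scaleR_add_right)
  also have "\<dots> = c * integral {-L..L} (\<lambda>t. \<kappa> t *\<^sub>R J v t) + d * integral {-L..L} (\<lambda>t. \<kappa> t *\<^sub>R J w t)"
    by (intro integral_lincomb intJ v w)
  finally show ?thesis
    by (simp add: hmm_flux_eq_integral v w J_def)
qed

end

text \<open>Fixing the two constants as parameters allows the mean square on [-R, R], and the
  extension of the flux to its limits, to be definitions.\<close>

locale hmm_flux_bounded = hmm_setting +
  fixes R C :: real
  assumes R_pos: "0 < R" and C_pos: "0 < C"
    and flux_bound: "\<And>Q v \<sigma>. wave_solution a \<epsilon> Q v \<Longrightarrow> 0 < \<sigma> \<Longrightarrow>
      integral {-R..R} (\<lambda>x. (norm (Q x))\<^sup>2) \<le> \<sigma>\<^sup>2 \<Longrightarrow> norm (hmm_flux a K \<epsilon> \<eta> v) \<le> C * \<sigma>"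

lemma (in hmm_setting) hmm_flux_bounded_ex: "\<exists>R C. hmm_flux_bounded a K \<epsilon> \<eta> R C"
proof (rule hmm_flux_bound)
  fix R C :: real
  assume "0 < R" "0 < C" and "\<And>Q v \<sigma>. wave_solution a \<epsilon> Q v \<Longrightarrow> 0 < \<sigma> \<Longrightarrow>
      integral {-R..R} (\<lambda>x. (norm (Q x))\<^sup>2) \<le> \<sigma>\<^sup>2 \<Longrightarrow> norm (hmm_flux a K \<epsilon> \<eta> v) \<le> C * \<sigma>"
  then have "hmm_flux_bounded a K \<epsilon> \<eta> R C"
    by unfold_locales
  then show ?thesis by blast
qed

context hmm_flux_bounded
begin

definition msq :: "(real \<Rightarrow> complex) \<Rightarrow> real" where
  "msq f = integral {-R..R} (\<lambda>x. (norm (f x))\<^sup>2)"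

text \<open>The graph of the continuous extension of the flux functional to limits, in the mean
  square on \<open>[-R, R]\<close>, of data that have a classical solution. No existence theorem for the
  wave equation is needed.\<close>

definition flux_limit :: "(real \<Rightarrow> complex) \<Rightarrow> complex \<Rightarrow> bool" where
  "flux_limit f z \<longleftrightarrow> continuous_on {-R..R} f \<and>
     (\<forall>\<delta>>0. \<exists>Q v. wave_solution a \<epsilon> Q v \<and> msq (\<lambda>x. Q x - f x) \<le> \<delta>\<^sup>2 \<and>
        norm (hmm_flux a K \<epsilon> \<eta> v - z) \<le> \<delta>)"

lemma msq_0 [simp]: "msq (\<lambda>x. 0) = 0"
  by (simp add: msq_def)

lemma msq_nonneg: "0 \<le> msq f"
proof (cases "(\<lambda>x. (norm (f x))\<^sup>2) integrable_on {-R..R}")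
  case True
  then show ?thesis unfolding msq_def by (intro Henstock_Kurzweil_Integration.integral_nonneg) auto
qed (simp add: msq_def not_integrable_integral)

lemma msq_minus_commute: "msq (\<lambda>x. f x - g x) = msq (\<lambda>x. g x - f x)"
  by (simp add: msq_def norm_minus_commute)

lemma msq_cmult: "msq (\<lambda>x. c * f x) = (norm c)\<^sup>2 * msq f"
  by (simp add: msq_def norm_mult power_mult_distrib)

text \<open>A squared substitute for the triangle inequality. Two errors with tolerance
  \<open>\<delta> / 2\<close> add up to exactly \<open>\<delta>\<^sup>2\<close>.\<close>

lemma msq_add_le:
  assumes f: "continuous_on {-R..R} f" and g: "continuous_on {-R..R} g"
  shows "msq (\<lambda>x. f x + g x) \<le> 2 * msq f + 2 * msq g"
proof -
  have "msq (\<lambda>x. f x + g x) \<le> integral {-R..R} (\<lambda>x. 2 * (norm (f x))\<^sup>2 + 2 * (norm (g x))\<^sup>2)"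
    unfolding msq_def
  proof (rule integral_le)
    show "(norm (f x + g x))\<^sup>2 \<le> 2 * (norm (f x))\<^sup>2 + 2 * (norm (g x))\<^sup>2" for x
    proof -
      have "(norm (f x + g x))\<^sup>2 \<le> (norm (f x) + norm (g x))\<^sup>2"
        by (intro power_mono norm_triangle_ineq) auto
      also have "\<dots> \<le> 2 * (norm (f x))\<^sup>2 + 2 * (norm (g x))\<^sup>2"
        using zero_le_power2[of "norm (f x) - norm (g x)"] by (simp add: power2_eq_square algebra_simps)
      finally show ?thesis .
    qed
  qed (intro integrable_continuous_real continuous_intros f g)+
  also have "\<dots> = 2 * msq f + 2 * msq g"
    unfolding msq_def
    by (subst Henstock_Kurzweil_Integration.integral_add)
      (auto intro!: integrable_continuous_real continuous_intros f g)
  finally show ?thesis .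
qed

text \<open>The factor \<open>1 + 2 * R\<close> dominates the square root of the length
  \<open>2 * R\<close>, which keeps roots out of the estimates.\<close>

lemma msq_le_uniform:
  assumes "continuous_on {-R..R} f" "\<And>x. x \<in> {-R..R} \<Longrightarrow> norm (f x) \<le> \<delta>"
  shows "msq f \<le> ((1 + 2 * R) * \<delta>)\<^sup>2"
proof -
  have "msq f \<le> integral {-R..R} (\<lambda>x. \<delta>\<^sup>2)"
    unfolding msq_def using assms
    by (intro integral_le integrable_continuous_norm_sq power_mono) auto
  also have "\<dots> = 2 * R * \<delta>\<^sup>2" using R_pos by simp
  also have "\<dots> \<le> (1 + 2 * R)\<^sup>2 * \<delta>\<^sup>2"
    using R_pos zero_le_power2[of R] by (intro mult_right_mono) (auto simp: power2_eq_square algebra_simps)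
  finally show ?thesis by (simp add: power_mult_distrib)
qed

lemma continuous_on_initial_data:
  assumes "wave_solution a \<epsilon> Q v"
  shows "continuous_on S Q"
proof -
  have "continuous_on S (\<lambda>x. v 0 x)"
    by (intro continuous_on_C1_plane wave_solution_C1_plane[OF assms] continuous_intros)
  then show ?thesis using assms by (simp add: wave_solution_def)
qed

lemma flux_limit_solution:
  assumes "wave_solution a \<epsilon> Q v"
  shows "flux_limit Q (hmm_flux a K \<epsilon> \<eta> v)"
  unfolding flux_limit_def using assms continuous_on_initial_data[OF assms]
  by (auto intro!: exI[of _ Q] exI[of _ v])

lemma flux_limit_continuous: "flux_limit f z \<Longrightarrow> continuous_on {-R..R} f"
  by (simp add: flux_limit_def)

lemma flux_limit_approx:
  assumes "flux_limit f z" "0 < \<delta>"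
  obtains Q v where "wave_solution a \<epsilon> Q v" "msq (\<lambda>x. Q x - f x) \<le> \<delta>\<^sup>2"
    "norm (hmm_flux a K \<epsilon> \<eta> v - z) \<le> \<delta>"
  using assms unfolding flux_limit_def by blast

lemma flux_limit_add:
  assumes f: "flux_limit f z" and g: "flux_limit g w"
  shows "flux_limit (\<lambda>x. f x + g x) (z + w)"
  unfolding flux_limit_def
proof (intro conjI allI impI)
  note fc = flux_limit_continuous[OF f] and gc = flux_limit_continuous[OF g]
  show "continuous_on {-R..R} (\<lambda>x. f x + g x)" by (intro continuous_intros fc gc)
  fix \<delta> :: real assume d: "0 < \<delta>"
  obtain P v where P: "wave_solution a \<epsilon> P v" "msq (\<lambda>x. P x - f x) \<le> (\<delta> / 2)\<^sup>2"
    "norm (hmm_flux a K \<epsilon> \<eta> v - z) \<le> \<delta> / 2"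
    using flux_limit_approx[OF f, of "\<delta> / 2"] d by auto
  obtain Q u where Q: "wave_solution a \<epsilon> Q u" "msq (\<lambda>x. Q x - g x) \<le> (\<delta> / 2)\<^sup>2"
    "norm (hmm_flux a K \<epsilon> \<eta> u - w) \<le> \<delta> / 2"
    using flux_limit_approx[OF g, of "\<delta> / 2"] d by auto
  have sol: "wave_solution a \<epsilon> (\<lambda>x. P x + Q x) (\<lambda>t x. v t x + u t x)"
    using wave_solution_lincomb[OF P(1) Q(1), of 1 1] by simp
  have flux: "hmm_flux a K \<epsilon> \<eta> (\<lambda>t x. v t x + u t x) = hmm_flux a K \<epsilon> \<eta> v + hmm_flux a K \<epsilon> \<eta> u"
    using hmm_flux_lincomb[OF wave_solution_C1_plane(1)[OF P(1)] wave_solution_C1_plane(1)[OF Q(1)], of 1 1]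
    by simp
  have "msq (\<lambda>x. (P x + Q x) - (f x + g x)) = msq (\<lambda>x. (P x - f x) + (Q x - g x))"
    by (simp add: algebra_simps)
  also have "\<dots> \<le> 2 * msq (\<lambda>x. P x - f x) + 2 * msq (\<lambda>x. Q x - g x)"
    by (intro msq_add_le continuous_intros fc gc continuous_on_initial_data[OF P(1)]
        continuous_on_initial_data[OF Q(1)])
  also have "\<dots> \<le> 2 * (\<delta> / 2)\<^sup>2 + 2 * (\<delta> / 2)\<^sup>2" using P(2) Q(2) by simp
  also have "\<dots> = \<delta>\<^sup>2" by (simp add: power2_eq_square)
  finally have m: "msq (\<lambda>x. (P x + Q x) - (f x + g x)) \<le> \<delta>\<^sup>2" .
  have "norm (hmm_flux a K \<epsilon> \<eta> v + hmm_flux a K \<epsilon> \<eta> u - (z + w)) \<le> \<delta>"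
    using norm_diff_triangle_ineq[of "hmm_flux a K \<epsilon> \<eta> v" "hmm_flux a K \<epsilon> \<eta> u" z w] P(3) Q(3) by simp
  with sol m show "\<exists>Q v. wave_solution a \<epsilon> Q v \<and> msq (\<lambda>x. Q x - (f x + g x)) \<le> \<delta>\<^sup>2 \<and>
      norm (hmm_flux a K \<epsilon> \<eta> v - (z + w)) \<le> \<delta>"
    unfolding flux[symmetric] by blast
qed

lemma flux_limit_cmult:
  assumes f: "flux_limit f z"
  shows "flux_limit (\<lambda>x. c * f x) (c * z)"
  unfolding flux_limit_def
proof (intro conjI allI impI)
  show "continuous_on {-R..R} (\<lambda>x. c * f x)"
    by (intro continuous_intros flux_limit_continuous[OF f])
  fix \<delta> :: real assume d: "0 < \<delta>"
  \<comment> \<open>The added 1 covers \<open>c = 0\<close>.\<close>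
  define \<delta>' where "\<delta>' = \<delta> / (norm c + 1)"
  have d': "0 < \<delta>'" unfolding \<delta>'_def using d by (intro divide_pos_pos add_nonneg_pos) auto
  have le: "norm c * \<delta>' \<le> \<delta>"
  proof -
    have "norm c * \<delta>' \<le> (norm c + 1) * \<delta>'" using d' by (intro mult_right_mono) auto
    also have "\<dots> = \<delta>" using add_nonneg_pos[OF norm_ge_zero[of c] zero_less_one] by (simp add: \<delta>'_def)
    finally show ?thesis .
  qed
  obtain P v where P: "wave_solution a \<epsilon> P v" "msq (\<lambda>x. P x - f x) \<le> \<delta>'\<^sup>2"
    "norm (hmm_flux a K \<epsilon> \<eta> v - z) \<le> \<delta>'"
    by (rule flux_limit_approx[OF f d'])
  have sol: "wave_solution a \<epsilon> (\<lambda>x. c * P x) (\<lambda>t x. c * v t x)"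
    using wave_solution_lincomb[OF P(1) P(1), of c 0] by simp
  have flux: "hmm_flux a K \<epsilon> \<eta> (\<lambda>t x. c * v t x) = c * hmm_flux a K \<epsilon> \<eta> v"
    using hmm_flux_lincomb[OF wave_solution_C1_plane(1)[OF P(1)] wave_solution_C1_plane(1)[OF P(1)], of c 0]
    by simp
  have "msq (\<lambda>x. c * P x - c * f x) = (norm c)\<^sup>2 * msq (\<lambda>x. P x - f x)"
    by (simp add: right_diff_distrib[symmetric] msq_cmult)
  also have "\<dots> \<le> (norm c)\<^sup>2 * \<delta>'\<^sup>2" using P(2) by (intro mult_left_mono) auto
  also have "\<dots> = (norm c * \<delta>')\<^sup>2" by (simp add: power_mult_distrib)
  also have "\<dots> \<le> \<delta>\<^sup>2" using le d' by (intro power_mono) auto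
  finally have m: "msq (\<lambda>x. c * P x - c * f x) \<le> \<delta>\<^sup>2" .
  have "norm (c * hmm_flux a K \<epsilon> \<eta> v - c * z) = norm c * norm (hmm_flux a K \<epsilon> \<eta> v - z)"
    by (simp add: right_diff_distrib[symmetric] norm_mult)
  also have "\<dots> \<le> norm c * \<delta>'" using P(3) by (intro mult_left_mono) auto
  finally have "norm (c * hmm_flux a K \<epsilon> \<eta> v - c * z) \<le> \<delta>" using le by linarith
  with sol m show "\<exists>Q v. wave_solution a \<epsilon> Q v \<and> msq (\<lambda>x. Q x - c * f x) \<le> \<delta>\<^sup>2 \<and>
      norm (hmm_flux a K \<epsilon> \<eta> v - c * z) \<le> \<delta>"
    unfolding flux[symmetric] by blast
qed

lemma flux_limit_diff:
  assumes "flux_limit f z" "flux_limit g w"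
  shows "flux_limit (\<lambda>x. f x - g x) (z - w)"
  using flux_limit_add[OF assms(1) flux_limit_cmult[OF assms(2), of "-1"]] by simp

text \<open>Approximation with tolerance \<sigma> itself gives data of mean square at most
  \<open>(2 * \<sigma>)\<^sup>2\<close>, hence a flux of at most \<open>2 * C * \<sigma>\<close>.
  The error of the flux adds one more \<sigma>.\<close>

lemma flux_limit_bound:
  assumes f: "flux_limit f z" and s: "0 < \<sigma>" and le: "msq f \<le> \<sigma>\<^sup>2"
  shows "norm z \<le> (2 * C + 1) * \<sigma>"
proof -
  obtain Q v where Q: "wave_solution a \<epsilon> Q v" "msq (\<lambda>x. Q x - f x) \<le> \<sigma>\<^sup>2"
    "norm (hmm_flux a K \<epsilon> \<eta> v - z) \<le> \<sigma>"
    by (rule flux_limit_approx[OF f s])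
  have "msq Q = msq (\<lambda>x. (Q x - f x) + f x)" by simp
  also have "\<dots> \<le> 2 * msq (\<lambda>x. Q x - f x) + 2 * msq f"
    by (intro msq_add_le continuous_intros continuous_on_initial_data[OF Q(1)] flux_limit_continuous[OF f])
  also have "\<dots> \<le> (2 * \<sigma>)\<^sup>2" using Q(2) le by (simp add: power_mult_distrib)
  finally have "norm (hmm_flux a K \<epsilon> \<eta> v) \<le> C * (2 * \<sigma>)"
    using s by (intro flux_bound[OF Q(1)]) (auto simp: msq_def)
  moreover have "norm z \<le> norm (hmm_flux a K \<epsilon> \<eta> v) + norm (hmm_flux a K \<epsilon> \<eta> v - z)"
    by (metis norm_minus_commute norm_triangle_sub)
  ultimately show ?thesis using Q(3) by (simp add: algebra_simps)
qed

lemma flux_limit_uniform_bound: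
  assumes f: "flux_limit f z" and d: "0 < \<delta>" and le: "\<And>x. x \<in> {-R..R} \<Longrightarrow> norm (f x) \<le> \<delta>"
  shows "norm z \<le> (2 * C + 1) * (1 + 2 * R) * \<delta>"
  using flux_limit_bound[OF f _ msq_le_uniform[OF flux_limit_continuous[OF f] le]] d R_pos
  by (simp add: mult.assoc)

text \<open>By linearity the difference of the two values belongs to the zero function and is
  therefore arbitrarily small. This converts membership in the relation into the equations of the
  theorem.\<close>

lemma flux_limit_unique:
  assumes "flux_limit f z" "flux_limit f w"
  shows "z = w"
proof (rule ccontr)
  assume ne: "z \<noteq> w"
  define c where "c = 2 * C + 1"
  have c: "0 < c" using C_pos by (simp add: c_def)
  \<comment> \<open>Chosen so that the bound is half of the norm it bounds.\<close>
  define \<sigma> where "\<sigma> = norm (z - w) / (2 * c)"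
  have s: "0 < \<sigma>" using ne c by (simp add: \<sigma>_def)
  have "flux_limit (\<lambda>x. 0) (z - w)"
    using flux_limit_diff[OF assms] by simp
  from flux_limit_bound[OF this s] have "norm (z - w) \<le> c * \<sigma>" by (simp add: c_def)
  also have "\<dots> = norm (z - w) / 2" using c by (simp add: \<sigma>_def)
  finally show False using ne by simp
qed

text \<open>Scaling any member by 0 yields the zero pair, the start of the induction over Bloch
  partial sums.\<close>

lemma flux_limit_0:
  assumes "flux_limit f z"
  shows "flux_limit (\<lambda>x. 0) 0"
  using flux_limit_cmult[OF assms, of 0] by simp

lemma flux_limit_sum:
  assumes "finite I" "I \<noteq> {}" "\<And>i. i \<in> I \<Longrightarrow> flux_limit (f i) (z i)"
  shows "flux_limit (\<lambda>x. \<Sum>i\<in>I. f i x) (\<Sum>i\<in>I. z i)"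
  using assms by (induction I rule: finite_ne_induct) (auto intro: flux_limit_add)

lemma flux_limit_closed:
  assumes f: "continuous_on {-R..R} f"
    and approx: "\<And>\<delta>. 0 < \<delta> \<Longrightarrow> \<exists>g w. flux_limit g w \<and> msq (\<lambda>x. g x - f x) \<le> \<delta>\<^sup>2 \<and> norm (w - z) \<le> \<delta>"
  shows "flux_limit f z"
  unfolding flux_limit_def
proof (intro conjI allI impI f)
  fix \<delta> :: real assume d: "0 < \<delta>"
  obtain g w where g: "flux_limit g w" "msq (\<lambda>x. g x - f x) \<le> (\<delta> / 2)\<^sup>2" "norm (w - z) \<le> \<delta> / 2"
    using approx[of "\<delta> / 2"] d by auto
  obtain Q v where Q: "wave_solution a \<epsilon> Q v" "msq (\<lambda>x. Q x - g x) \<le> (\<delta> / 2)\<^sup>2"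
    "norm (hmm_flux a K \<epsilon> \<eta> v - w) \<le> \<delta> / 2"
    using flux_limit_approx[OF g(1), of "\<delta> / 2"] d by auto
  have "msq (\<lambda>x. Q x - f x) = msq (\<lambda>x. (Q x - g x) + (g x - f x))" by simp
  also have "\<dots> \<le> 2 * msq (\<lambda>x. Q x - g x) + 2 * msq (\<lambda>x. g x - f x)"
    by (intro msq_add_le continuous_intros continuous_on_initial_data[OF Q(1)]
        flux_limit_continuous[OF g(1)] f)
  also have "\<dots> \<le> 2 * (\<delta> / 2)\<^sup>2 + 2 * (\<delta> / 2)\<^sup>2" using g(2) Q(2) by simp
  also have "\<dots> = \<delta>\<^sup>2" by (simp add: power2_eq_square)
  finally have "msq (\<lambda>x. Q x - f x) \<le> \<delta>\<^sup>2" .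
  moreover have "norm (hmm_flux a K \<epsilon> \<eta> v - z) \<le> \<delta>"
    using norm_triangle_ineq[of "hmm_flux a K \<epsilon> \<eta> v - w" "w - z"] g(3) Q(3) by simp
  ultimately show "\<exists>Q v. wave_solution a \<epsilon> Q v \<and> msq (\<lambda>x. Q x - f x) \<le> \<delta>\<^sup>2 \<and>
      norm (hmm_flux a K \<epsilon> \<eta> v - z) \<le> \<delta>"
    using Q(1) by blast
qed

lemma flux_limit_uniform_closed:
  assumes f: "continuous_on {-R..R} f"
    and approx: "\<And>\<delta>. 0 < \<delta> \<Longrightarrow> \<exists>g w. flux_limit g w \<and>
      (\<forall>x\<in>{-R..R}. norm (g x - f x) \<le> \<delta>) \<and> norm (w - z) \<le> \<delta>"
  shows "flux_limit f z"
proof (rule flux_limit_closed[OF f])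
  fix \<delta> :: real assume d: "0 < \<delta>"
  define \<delta>' where "\<delta>' = \<delta> / (1 + 2 * R)"
  have d': "0 < \<delta>'" "(1 + 2 * R) * \<delta>' = \<delta>" "\<delta>' \<le> \<delta>"
    using d R_pos by (auto simp: \<delta>'_def field_simps)
  obtain g w where g: "flux_limit g w" "\<And>x. x \<in> {-R..R} \<Longrightarrow> norm (g x - f x) \<le> \<delta>'"
    "norm (w - z) \<le> \<delta>'"
    using approx[OF d'(1)] by blast
  have "msq (\<lambda>x. g x - f x) \<le> ((1 + 2 * R) * \<delta>')\<^sup>2"
    by (intro msq_le_uniform continuous_intros flux_limit_continuous[OF g(1)] f g(2))
  with g d' show "\<exists>g w. flux_limit g w \<and> msq (\<lambda>x. g x - f x) \<le> \<delta>\<^sup>2 \<and> norm (w - z) \<le> \<delta>"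
    by (metis order_trans)
qed

text \<open>Convergence of the values is a conclusion: mean square convergence of the functions
  makes the values a Cauchy sequence. This is the source of the convergence of the series for
  W.\<close>

lemma flux_limit_LIMSEQ:
  assumes g: "\<And>n. flux_limit (g n) (z n)" and f: "continuous_on {-R..R} f"
    and lim: "(\<lambda>n. msq (\<lambda>x. g n x - f x)) \<longlonglongrightarrow> 0"
  shows "\<exists>w. z \<longlonglongrightarrow> w \<and> flux_limit f w"
proof -
  have small: "\<exists>N. \<forall>n\<ge>N. msq (\<lambda>x. g n x - f x) \<le> \<delta>\<^sup>2" if "0 < \<delta>" for \<delta>
  proof -
    have "\<forall>\<^sub>F n in sequentially. msq (\<lambda>x. g n x - f x) < \<delta>\<^sup>2"
      using lim that by (intro order_tendstoD) auto
    then show ?thesis unfolding eventually_sequentially by (meson less_imp_le)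
  qed
  have "Cauchy z"
  proof (rule CauchyI)
    fix e :: real assume e: "0 < e"
    \<comment> \<open>Two errors \<delta> give mean square at most
      \<open>(2 * \<delta>)\<^sup>2\<close>, so the values differ by at most
      \<open>(2 * C + 1) * (2 * \<delta>) = e / 2\<close>.\<close>
    define \<delta> where "\<delta> = e / (4 * (2 * C + 1))"
    have d: "0 < \<delta>" using e C_pos by (simp add: \<delta>_def)
    obtain N where N: "\<And>n. N \<le> n \<Longrightarrow> msq (\<lambda>x. g n x - f x) \<le> \<delta>\<^sup>2"
      using small[OF d] by blast
    have "norm (z m - z n) < e" if "N \<le> m" "N \<le> n" for m n
    proof -
      have "msq (\<lambda>x. g m x - g n x) = msq (\<lambda>x. (g m x - f x) + (f x - g n x))" by simp
      also have "\<dots> \<le> 2 * msq (\<lambda>x. g m x - f x) + 2 * msq (\<lambda>x. f x - g n x)"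
        by (intro msq_add_le continuous_intros flux_limit_continuous[OF g] f)
      also have "\<dots> \<le> (2 * \<delta>)\<^sup>2"
        using N[OF that(1)] N[OF that(2)] msq_minus_commute[of f "g n"] by (simp add: power_mult_distrib)
      finally have "norm (z m - z n) \<le> (2 * C + 1) * (2 * \<delta>)"
        using d by (intro flux_limit_bound[OF flux_limit_diff[OF g g]]) auto
      also have "\<dots> = e / 2" using C_pos by (simp add: \<delta>_def field_simps)
      finally show ?thesis using e by simp
    qed
    then show "\<exists>M. \<forall>m\<ge>M. \<forall>n\<ge>M. norm (z m - z n) < e" by blast
  qed
  then obtain w where w: "z \<longlonglongrightarrow> w"
    using convergent_eq_Cauchy by blast
  have "flux_limit f w"
  proof (rule flux_limit_closed[OF f])
    fix \<delta> :: real assume d: "0 < \<delta>"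
    obtain N where N: "\<And>n. N \<le> n \<Longrightarrow> msq (\<lambda>x. g n x - f x) \<le> \<delta>\<^sup>2"
      using small[OF d] by blast
    obtain M where M: "\<And>n. M \<le> n \<Longrightarrow> norm (z n - w) < \<delta>"
      using LIMSEQ_D[OF w d] by blast
    show "\<exists>g w'. flux_limit g w' \<and> msq (\<lambda>x. g x - f x) \<le> \<delta>\<^sup>2 \<and> norm (w' - w) \<le> \<delta>"
      using g[of "max M N"] N[of "max M N"] M[of "max M N"] by (meson less_imp_le max.cobounded1 max.cobounded2)
  qed
  with w show ?thesis by blast
qed

end

section \<open>Bloch waves\<close>

lemma periodic_integral_translate:
  fixes g :: "real \<Rightarrow> real"
  assumes per: "\<And>y. g (y + 1) = g y" and cont: "continuous_on UNIV g"
  shows "integral {c + 1..d + 1} g = integral {c..d} g"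
proof -
  have "(g has_integral integral {c + 1..d + 1} g) (cbox (c + 1) (d + 1))"
    using integrable_continuous_real[OF continuous_on_subset[OF cont subset_UNIV], of "c + 1" "d + 1"]
    by (simp add: has_integral_integral)
  from has_integral_affinity'[OF this, of 1 1] show ?thesis
    by (simp add: per integral_unique)
qed

text \<open>The induction adds one cell at each end, so that the union stays centred on the cell
  that carries the orthonormal basis.\<close>

lemma periodic_integral_cells:
  fixes g :: "real \<Rightarrow> real"
  assumes per: "\<And>y. g (y + 1) = g y" and cont: "continuous_on UNIV g"
  shows "integral {- 1 / 2 - real n..1 / 2 + real n} g = (2 * real n + 1) * integral {- 1 / 2..1 / 2} g"
proof -
  define I where "I = integral {- 1 / 2..1 / 2} g"
  have int: "g integrable_on {c..d}" for c d
    by (intro integrable_continuous_real continuous_on_subset[OF cont subset_UNIV])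
  have right: "integral {real n - 1 / 2..real n + 1 / 2} g = I" for n
  proof (induction n)
    case (Suc n)
    then show ?case
      using periodic_integral_translate[OF per cont, of "real n - 1 / 2" "real n + 1 / 2"]
      by (simp add: algebra_simps)
  qed (simp add: I_def)
  have left: "integral {- real n - 1 / 2..- real n + 1 / 2} g = I" for n
  proof (induction n)
    case (Suc n)
    then show ?case
      using periodic_integral_translate[OF per cont, of "- real (Suc n) - 1 / 2" "- real (Suc n) + 1 / 2"]
      by (simp add: algebra_simps)
  qed (simp add: I_def)
  have "integral {- 1 / 2 - real n..1 / 2 + real n} g = (2 * real n + 1) * I"
  proof (induction n)
    case (Suc n)
    let ?l = "- 1 / 2 - real n" and ?r = "1 / 2 + real n"
    have "integral {?l - 1..?r + 1} g = integral {?l - 1..?l} g + (integral {?l..?r} g + integral {?r..?r + 1} g)"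
      using Henstock_Kurzweil_Integration.integral_combine[OF _ _ int, of "?l - 1" ?l "?r + 1"]
        Henstock_Kurzweil_Integration.integral_combine[OF _ _ int, of ?l ?r "?r + 1"] by simp
    also have "integral {?l - 1..?l} g = I"
      using left[of "Suc n"] by (simp add: algebra_simps)
    also have "integral {?r..?r + 1} g = I"
      using right[of "Suc n"] by (simp add: algebra_simps)
    finally show ?case
      using Suc by (simp add: algebra_simps)
  qed (simp add: I_def)
  then show ?thesis by (simp add: I_def)
qed

text \<open>In the fast variable, [-R, R] is covered by \<open>2 * n + 1\<close> whole cells. This
  carries convergence on a single cell over to [-R, R].\<close>

lemma periodic_integral_bound:
  fixes g :: "real \<Rightarrow> real"
  assumes per: "\<And>y. g (y + 1) = g y" and cont: "continuous_on UNIV g" and pos: "\<And>y. 0 \<le> g y"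
    and eps: "0 < \<epsilon>" and n: "R / \<epsilon> \<le> real n"
  shows "integral {-R..R} (\<lambda>x. g (x / \<epsilon>)) \<le> \<epsilon> * (2 * real n + 1) * integral {- 1 / 2..1 / 2} g"
proof -
  have int: "g integrable_on {c..d}" for c d
    by (intro integrable_continuous_real continuous_on_subset[OF cont subset_UNIV])
  have "(g has_integral integral {-R/\<epsilon>..R/\<epsilon>} g) (cbox (-R/\<epsilon>) (R/\<epsilon>))"
    using int by (simp add: has_integral_integral)
  from has_integral_affinity'[OF this, of "1 / \<epsilon>" 0]
  have "((\<lambda>x. g (x / \<epsilon>)) has_integral \<epsilon> * integral {-R/\<epsilon>..R/\<epsilon>} g) {-R..R}"
    using eps by simp
  then have "integral {-R..R} (\<lambda>x. g (x / \<epsilon>)) = \<epsilon> * integral {-R/\<epsilon>..R/\<epsilon>} g"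
    by (rule integral_unique)
  also have "\<dots> \<le> \<epsilon> * integral {- 1 / 2 - real n..1 / 2 + real n} g"
    using n eps int pos by (intro mult_left_mono integral_subset_le) auto
  also have "\<dots> = \<epsilon> * (2 * real n + 1) * integral {- 1 / 2..1 / 2} g"
    using periodic_integral_cells[OF per cont, of n] by simp
  finally show ?thesis .
qed

lemma C1_plane_prod:
  assumes c: "\<And>t. (c has_vector_derivative c' t) (at t)" "continuous_on UNIV c'"
    and f: "\<And>x. (f has_vector_derivative f' x) (at x)" "continuous_on UNIV f'"
  shows "C1_plane (\<lambda>t x. c t * f x)" and "pd_t (\<lambda>t x. c t * f x) = (\<lambda>t x. c' t * f x)"
    and "pd_x (\<lambda>t x. c t * f x) = (\<lambda>t x. c t * f' x)"
proof -
  have cont: "continuous_on UNIV c" "continuous_on UNIV f"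
    by (rule continuous_on_has_vector_derivative[OF c(1)], rule continuous_on_has_vector_derivative[OF f(1)])
  note cont' = continuous_on_compose2[OF cont(1) _ subset_UNIV] continuous_on_compose2[OF cont(2) _ subset_UNIV]
    continuous_on_compose2[OF c(2) _ subset_UNIV] continuous_on_compose2[OF f(2) _ subset_UNIV]
  have 1: "((\<lambda>t. c t * f x) has_vector_derivative c' t * f x) (at t)" for t x
    by (rule has_vector_derivative_mult_left[OF c(1)])
  have 2: "((\<lambda>x. c t * f x) has_vector_derivative c t * f' x) (at x)" for t x
    by (rule has_vector_derivative_mult_right[OF f(1)])
  have ct: "continuous_on UNIV (\<lambda>(t, x). c' t * f x)"
    unfolding case_prod_beta' by (intro cont' continuous_intros)
  have cx: "continuous_on UNIV (\<lambda>(t, x). c t * f' x)"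
    unfolding case_prod_beta' by (intro cont' continuous_intros)
  show "C1_plane (\<lambda>t x. c t * f x)" "pd_t (\<lambda>t x. c t * f x) = (\<lambda>t x. c' t * f x)"
    "pd_x (\<lambda>t x. c t * f x) = (\<lambda>t x. c t * f' x)"
    using C1_planeI[OF 1 2 ct cx] by auto
qed

section \<open>Plane waves and separated Bloch solutions\<close>

context hmm_setting
begin

definition plane_wave :: "real \<Rightarrow> real \<Rightarrow> complex" where
  "plane_wave k x = exp (\<i> * of_real (k * x / \<epsilon>))"

lemma norm_plane_wave [simp]: "norm (plane_wave k x) = 1"
  unfolding plane_wave_def by (rule norm_exp_i_times)

lemma plane_wave_has_vector_derivative:
  "(plane_wave k has_vector_derivative \<i> * of_real (k / \<epsilon>) * plane_wave k x) (at x)"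
proof -
  have "((\<lambda>z. exp (\<i> * of_real (k / \<epsilon>) * z)) has_field_derivative
      exp (\<i> * of_real (k / \<epsilon>) * of_real x) * (\<i> * of_real (k / \<epsilon>))) (at (of_real x))"
    using eps_pos by (auto intro!: derivative_eq_intros)
  from has_vector_derivative_real_field[OF this] show ?thesis
    unfolding plane_wave_def by (simp add: mult_ac)
qed

lemma continuous_on_plane_wave: "continuous_on S g \<Longrightarrow> continuous_on S (\<lambda>z. plane_wave k (g z))"
  unfolding plane_wave_def using eps_pos by (intro continuous_intros) auto

text \<open>Multiplication by the plane wave conjugates the x-derivative into the shifted derivative
  of the cell problem, divided by \<epsilon>.\<close>

lemma modulated_has_vector_derivative:
  assumes "(g has_vector_derivative g') (at (x / \<epsilon>))"
  shows "((\<lambda>x. g (x / \<epsilon>) * plane_wave k x) has_vector_derivative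
    shifted_deriv k g (x / \<epsilon>) * plane_wave k x / of_real \<epsilon>) (at x)"
proof -
  have "((\<lambda>x. x / \<epsilon>) has_vector_derivative 1 / \<epsilon>) (at x)"
    unfolding has_real_derivative_iff_has_vector_derivative[symmetric]
    using eps_pos by (auto intro!: derivative_eq_intros)
  from vector_diff_chain_at[OF this assms]
  have "((\<lambda>x. g (x / \<epsilon>)) has_vector_derivative g' / of_real \<epsilon>) (at x)"
    using eps_pos by (simp add: o_def scaleR_conv_of_real field_simps)
  from has_vector_derivative_mult[OF this plane_wave_has_vector_derivative[of k]]
  show ?thesis
    using eps_pos by (simp add: shifted_deriv_def vector_derivative_at[OF assms] field_simps)
qed

text \<open>Separation of variables: the spatial factor is an eigenfunction of the oscillating
  operator with eigenvalue \<open>(\<omega> / \<epsilon>)\<^sup>2\<close>, and the cosine has zero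
  initial velocity.\<close>

lemma bloch_mode_wave_solution:
  assumes pair: "bloch_eigenpair a k (\<omega>\<^sup>2) \<phi>"
  shows "wave_solution a \<epsilon> (\<lambda>x. \<phi> (x / \<epsilon>) * plane_wave k x)
           (\<lambda>t x. of_real (cos (\<omega> * t / \<epsilon>)) * (\<phi> (x / \<epsilon>) * plane_wave k x))" (is ?sol)
    and "pd_x (\<lambda>t x. of_real (cos (\<omega> * t / \<epsilon>)) * (\<phi> (x / \<epsilon>) * plane_wave k x)) =
      (\<lambda>t x. of_real (cos (\<omega> * t / \<epsilon>)) *
        vector_derivative (\<lambda>x. \<phi> (x / \<epsilon>) * plane_wave k x) (at x))" (is ?px)
proof -
  have C2: "Ck_on 2 \<phi> UNIV"
    and eq: "\<And>y. - shifted_deriv k (\<lambda>z. of_real (a z) * shifted_deriv k \<phi> z) y = of_real (\<omega>\<^sup>2) * \<phi> y"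
    using pair by (auto simp: bloch_eigenpair_def)
  define \<phi>1 where "\<phi>1 = shifted_deriv k \<phi>"
  define \<phi>2 where "\<phi>2 = shifted_deriv k \<phi>1"
  have d1: "(\<phi> has_vector_derivative nth_vderiv 1 \<phi> y) (at y)" for y
    using Ck_on_has_vector_derivative[OF C2, of 0 y] by simp
  have \<phi>1: "\<phi>1 = (\<lambda>y. nth_vderiv 1 \<phi> y + \<i> * of_real k * \<phi> y)"
    by (simp add: \<phi>1_def fun_eq_iff shifted_deriv_def nth_vderiv_Suc)
  have d2: "(\<phi>1 has_vector_derivative nth_vderiv 2 \<phi> y + \<i> * of_real k * nth_vderiv 1 \<phi> y) (at y)" for y
    unfolding \<phi>1 using Ck_on_has_vector_derivative[OF C2, of 1 y]
    by (intro has_vector_derivative_add has_vector_derivative_mult_right d1)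
      (simp_all add: numeral_2_eq_2)
  have \<phi>2: "\<phi>2 = (\<lambda>y. nth_vderiv 2 \<phi> y + \<i> * of_real k * nth_vderiv 1 \<phi> y + \<i> * of_real k * \<phi>1 y)"
    by (simp add: \<phi>2_def fun_eq_iff shifted_deriv_def vector_derivative_at[OF d2])
  have c1: "continuous_on UNIV \<phi>1"
    by (rule continuous_on_has_vector_derivative[OF d2])
  have c2: "continuous_on UNIV \<phi>2"
  proof -
    have "continuous_on UNIV (nth_vderiv 1 \<phi>)" "continuous_on UNIV (nth_vderiv 2 \<phi>)"
      using Ck_on_antimono[OF C2, of 1] C2 by (auto simp: Ck_on_def)
    then show ?thesis unfolding \<phi>2 by (intro continuous_intros c1)
  qed
  define f where "f = (\<lambda>x. \<phi> (x / \<epsilon>) * plane_wave k x)"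
  define f1 where "f1 = (\<lambda>x. \<phi>1 (x / \<epsilon>) * plane_wave k x / of_real \<epsilon>)"
  define f2 where "f2 = (\<lambda>x. \<phi>2 (x / \<epsilon>) * plane_wave k x / of_real \<epsilon> / of_real \<epsilon>)"
  have f: "(f has_vector_derivative f1 x) (at x)" for x
    unfolding f_def f1_def \<phi>1_def by (rule modulated_has_vector_derivative[OF d1])
  have f1: "(f1 has_vector_derivative f2 x) (at x)" for x
    using modulated_has_vector_derivative[OF d2, where x = x and k = k, THEN has_vector_derivative_divide, of "of_real \<epsilon>"]
    unfolding f1_def f2_def \<phi>2_def .
  have cf1: "continuous_on UNIV f1"
    by (rule continuous_on_has_vector_derivative[OF f1])
  have cf2: "continuous_on UNIV f2"
    unfolding f2_def using eps_pos
    by (intro continuous_intros continuous_on_plane_wave continuous_on_compose2[OF c2]) auto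
  define c where "c = (\<lambda>t. complex_of_real (cos (\<omega> * t / \<epsilon>)))"
  define c' where "c' = (\<lambda>t. complex_of_real (- (\<omega> / \<epsilon>) * sin (\<omega> * t / \<epsilon>)))"
  define c'' where "c'' = (\<lambda>t. complex_of_real (- (\<omega> / \<epsilon>)\<^sup>2 * cos (\<omega> * t / \<epsilon>)))"
  have c: "(c has_vector_derivative c' t) (at t)" for t
    unfolding c_def c'_def
    by (intro has_vector_derivative_of_real) (use eps_pos in \<open>auto intro!: derivative_eq_intros\<close>)
  have c': "(c' has_vector_derivative c'' t) (at t)" for t
    unfolding c'_def c''_def
    by (intro has_vector_derivative_of_real) (use eps_pos in \<open>auto intro!: derivative_eq_intros simp: power2_eq_square\<close>)
  have cc: "continuous_on UNIV c'" "continuous_on UNIV c''"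
    unfolding c'_def c''_def using eps_pos by (intro continuous_intros; simp)+
  note v = C1_plane_prod[OF c cc(1) f cf1]
  note vt = C1_plane_prod[OF c' cc(2) f cf1]
  note vx = C1_plane_prod[OF c cc(1) f1 cf2]
  have Af1: "((\<lambda>x. A x *\<^sub>R f1 x) has_vector_derivative - of_real ((\<omega> / \<epsilon>)\<^sup>2) * f x) (at x)" for x
  proof -
    \<comment> \<open>The conjugation rule applied a second time, now to \<open>a\<close> times the
      shifted derivative; the eigenvalue equation evaluates the result.\<close>
    define g where "g = (\<lambda>y. of_real (a y) * \<phi>1 y)"
    have "(g has_vector_derivative of_real (a y) * (nth_vderiv 2 \<phi> y + \<i> * of_real k * nth_vderiv 1 \<phi> y)
        + of_real (nth_vderiv 1 a y) * \<phi>1 y) (at y)" for y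
      unfolding g_def using DERIV_a
      by (intro has_vector_derivative_mult d2 has_vector_derivative_of_real)
        (simp add: has_real_derivative_iff_has_vector_derivative)
    from modulated_has_vector_derivative[OF this, where x = x and k = k, THEN has_vector_derivative_divide, of "of_real \<epsilon>"]
    have "((\<lambda>x. g (x / \<epsilon>) * plane_wave k x / of_real \<epsilon>) has_vector_derivative
        shifted_deriv k g (x / \<epsilon>) * plane_wave k x / of_real \<epsilon> / of_real \<epsilon>) (at x)" .
    moreover have "shifted_deriv k g (x / \<epsilon>) = - of_real (\<omega>\<^sup>2) * \<phi> (x / \<epsilon>)"
      using eq[of "x / \<epsilon>"] unfolding g_def \<phi>1_def by (metis minus_mult_left minus_minus)
    ultimately show ?thesis
      by (simp add: g_def f1_def f_def A_def scaleR_conv_of_real power2_eq_square mult_ac)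
  qed
  have sol: "wave_solution a \<epsilon> f (\<lambda>t x. c t * f x)"
  proof (rule wave_solutionI, unfold v vt)
    fix t x
    have "((\<lambda>y. c t * (A y *\<^sub>R f1 y)) has_vector_derivative
        c t * (- of_real ((\<omega> / \<epsilon>)\<^sup>2) * f x)) (at x)"
      by (intro has_vector_derivative_mult_right Af1)
    then show "((\<lambda>y. A y *\<^sub>R (c t * f1 y)) has_vector_derivative c'' t * f x) (at x)"
      by (simp add: c_def c''_def mult_ac)
  qed (rule v(1) vt(1) vx(1) | simp add: c_def c'_def)+
  then show ?sol by (simp add: f_def c_def)
  show ?px using v(3) vector_derivative_at[OF f] by (simp add: f_def c_def)
qed

text \<open>The kernel and the solution are both products of a function of t and a function of x, so
  the double integral factors.\<close>

lemma bloch_mode_flux: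
  assumes pair: "bloch_eigenpair a k ((\<omega> m k)\<^sup>2) (\<psi> m k)"
  shows "hmm_flux a K \<epsilon> \<eta> (\<lambda>t x. of_real (cos (\<omega> m k * t / \<epsilon>)) * (\<psi> m k (x / \<epsilon>) * plane_wave k x))
    = of_real (bloch_s K \<epsilon> \<eta> \<omega> m k) * bloch_w a K \<epsilon> \<eta> \<psi> m k / of_real \<epsilon>"
proof -
  define Z where "Z = (\<integral>x. of_real (scaled_kernel K \<eta> x * a (x / \<epsilon>)) *
        vector_derivative (\<lambda>z. \<psi> m k (z / \<epsilon>) * plane_wave k z) (at x) \<partial>lborel)"
  have w: "bloch_w a K \<epsilon> \<eta> \<psi> m k = of_real \<epsilon> * Z"
    by (simp add: bloch_w_def Z_def plane_wave_def)
  have inner: "(\<integral>x. of_real (scaled_kernel K \<eta> x * scaled_kernel K \<eta> t * a (x / \<epsilon>)) *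
      (of_real (cos (\<omega> m k * t / \<epsilon>)) * vector_derivative (\<lambda>x. \<psi> m k (x / \<epsilon>) * plane_wave k x) (at x))
      \<partial>lborel) = of_real (scaled_kernel K \<eta> t * cos (\<omega> m k * t / \<epsilon>)) * Z" for t
    unfolding Z_def Bochner_Integration.integral_mult_right_zero[symmetric]
    by (intro Bochner_Integration.integral_cong) simp_all
  show ?thesis
    unfolding hmm_flux_def bloch_mode_wave_solution(2)[OF pair] inner w bloch_s_def
      Bochner_Integration.integral_mult_left_zero integral_complex_of_real
    using eps_pos by simp
qed

end

context hmm_flux_bounded
begin

text \<open>The numbers \<open>bloch_b \<psi> m k\<close> are the coefficients of the constant
  function 1 in the basis at wave number k. Multiplying its expansion by the plane wave gives a
  series of separated solutions at time 0, and their fluxes add up to W.\<close>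

lemma flux_limit_plane_wave:
  assumes bloch: "bloch_waves a \<omega> \<psi>" and k: "k \<in> {-pi..pi}"
  shows "flux_limit (plane_wave k) (bloch_W a K \<epsilon> \<eta> \<omega> \<psi> k / of_real \<epsilon>)"
proof -
  have pair: "bloch_eigenpair a k ((\<omega> m k)\<^sup>2) (\<psi> m k)" for m
    using bloch k by (auto simp: bloch_waves_def)
  have onb: "orthonormal_basis_cell (\<lambda>m. \<psi> m k)"
    using bloch k by (auto simp: bloch_waves_def)
  have per: "\<psi> m k (y + 1) = \<psi> m k y" for m y
    using pair[of m] by (simp add: bloch_eigenpair_def)
  have cont: "continuous_on S (\<psi> m k)" for m S
  proof -
    have "Ck_on 0 (\<psi> m k) UNIV"
      using pair[of m] by (simp add: bloch_eigenpair_def Ck_on_antimono[of 2])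
    then have "continuous_on UNIV (\<psi> m k)" by (simp add: Ck_on_def)
    then show ?thesis by (rule continuous_on_subset) simp
  qed
  define b where "b = (\<lambda>m. bloch_b \<psi> m k)"
  define T where "T = (\<lambda>m. b m * of_real (bloch_s K \<epsilon> \<eta> \<omega> m k) * bloch_w a K \<epsilon> \<eta> \<psi> m k)"
  have mode: "flux_limit (\<lambda>x. b m * (\<psi> m k (x / \<epsilon>) * plane_wave k x)) (T m / of_real \<epsilon>)" for m
    using flux_limit_cmult[OF flux_limit_solution[OF bloch_mode_wave_solution(1)[OF pair]], of "b m" m]
    unfolding bloch_mode_flux[where \<omega> = \<omega> and \<psi> = \<psi>, OF pair] by (simp add: T_def mult.assoc)
  define S where "S = (\<lambda>N y. \<Sum>m<N. b m * \<psi> m k y)"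
  have partial: "flux_limit (\<lambda>x. S N (x / \<epsilon>) * plane_wave k x) ((\<Sum>m<N. T m) / of_real \<epsilon>)" for N
  proof (induction N)
    case 0
    show ?case using flux_limit_0[OF mode] by (simp add: S_def)
  next
    case (Suc N)
    from flux_limit_add[OF Suc mode[of N]] show ?case
      by (simp add: S_def add_divide_distrib algebra_simps)
  qed
  define g where "g = (\<lambda>N y. (norm (S N y - 1))\<^sup>2)"
  have g: "g N (y + 1) = g N y" "continuous_on X (g N)" "0 \<le> g N y" for N y X
    unfolding g_def S_def by (auto simp: per intro!: continuous_intros cont)
  have "(\<lambda>N. integral {- 1 / 2..1 / 2} (g N)) \<longlonglongrightarrow> 0"
  proof -
    \<comment> \<open>The basis lives on the open cell and the coefficients are integrals over the
      closed one; the end points do not change the value.\<close>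
    have open_closed: "(LBINT x:{- 1 / 2<..<1 / 2}. h x) = integral {- 1 / 2..1 / 2} h"
      if "continuous_on {- 1 / 2..1 / 2} h" for h :: "real \<Rightarrow> 'b::euclidean_space"
    proof -
      have "set_integrable lborel {- 1 / 2<..<1 / 2} h"
        by (rule set_integrable_subset[OF borel_integrable_atLeastAtMost'[OF that]]) auto
      from set_borel_integral_eq_integral(2)[OF this] show ?thesis
        by (simp add: integral_open_interval_real)
    qed
    have closed: "(LBINT x:{- 1 / 2..1 / 2}. h x) = integral {- 1 / 2..1 / 2} h"
      if "continuous_on {- 1 / 2..1 / 2} h" for h :: "real \<Rightarrow> 'b::euclidean_space"
      by (rule set_borel_integral_eq_integral(2)[OF borel_integrable_atLeastAtMost'[OF that]])
    have inner: "cell_inner (\<lambda>x. 1) (\<psi> m k) = b m" for m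
    proof -
      have "continuous_on {- 1 / 2..1 / 2} (\<lambda>x. cnj (\<psi> m k x))"
        by (intro continuous_intros cont)
      then show ?thesis
        unfolding cell_inner_def b_def bloch_b_def mult_1_left by (simp only: open_closed closed)
    qed
    have "L2_on {- 1 / 2<..<1 / 2} (\<lambda>x. 1)"
      unfolding L2_on_def set_borel_measurable_def set_integrable_def by simp
    then have "(\<lambda>N. LBINT x:{- 1 / 2<..<1 / 2}.
        (cmod (1 - (\<Sum>m<N. cell_inner (\<lambda>x. 1) (\<psi> m k) * \<psi> m k x)))\<^sup>2) \<longlonglongrightarrow> 0"
      using onb unfolding orthonormal_basis_cell_def by blast
    moreover have "(LBINT x:{- 1 / 2<..<1 / 2}.
        (cmod (1 - (\<Sum>m<N. cell_inner (\<lambda>x. 1) (\<psi> m k) * \<psi> m k x)))\<^sup>2) = integral {- 1 / 2..1 / 2} (g N)" for N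
      unfolding inner using open_closed[OF g(2)[of _ N]]
      by (simp add: g_def S_def norm_minus_commute)
    ultimately show ?thesis by simp
  qed
  obtain n :: nat where n: "R / \<epsilon> \<le> real n" using real_arch_simple by blast
  define B where "B = \<epsilon> * (2 * real n + 1)"
  have msq: "msq (\<lambda>x. S N (x / \<epsilon>) * plane_wave k x - plane_wave k x) = integral {-R..R} (\<lambda>x. g N (x / \<epsilon>))" for N
  proof -
    have "norm (S N (x / \<epsilon>) * plane_wave k x - plane_wave k x) = norm (S N (x / \<epsilon>) - 1)" for x
      using norm_mult[of "S N (x / \<epsilon>) - 1" "plane_wave k x"] by (simp add: algebra_simps)
    then show ?thesis by (simp add: msq_def g_def)
  qed
  have "(\<lambda>N. msq (\<lambda>x. S N (x / \<epsilon>) * plane_wave k x - plane_wave k x)) \<longlonglongrightarrow> 0"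
  proof (rule tendsto_sandwich)
    show "\<forall>\<^sub>F N in sequentially. 0 \<le> msq (\<lambda>x. S N (x / \<epsilon>) * plane_wave k x - plane_wave k x)"
      by (intro always_eventually allI msq_nonneg)
    show "\<forall>\<^sub>F N in sequentially. msq (\<lambda>x. S N (x / \<epsilon>) * plane_wave k x - plane_wave k x)
        \<le> B * integral {- 1 / 2..1 / 2} (g N)"
      unfolding msq B_def by (intro always_eventually allI periodic_integral_bound g eps_pos n)
    show "(\<lambda>N. B * integral {- 1 / 2..1 / 2} (g N)) \<longlonglongrightarrow> 0"
      using tendsto_mult_right_zero[OF \<open>(\<lambda>N. integral {- 1 / 2..1 / 2} (g N)) \<longlonglongrightarrow> 0\<close>] .
  qed simp
  from flux_limit_LIMSEQ[OF partial continuous_on_plane_wave[OF continuous_on_id] this]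
  obtain w where w: "(\<lambda>N. (\<Sum>m<N. T m) / of_real \<epsilon>) \<longlonglongrightarrow> w" "flux_limit (plane_wave k) w"
    by auto
  have "(\<lambda>N. \<Sum>m<N. T m) \<longlonglongrightarrow> w * of_real \<epsilon>"
    using tendsto_mult_right[OF w(1), of "of_real \<epsilon>"] eps_pos by simp
  \<comment> \<open>The partial sums are known to converge by now, so the infinite sum in the
    definition of W is a genuine limit.\<close>
  then have "(\<Sum>m. T m) = w * of_real \<epsilon>"
    unfolding sums_def[symmetric] by (simp add: sums_iff)
  then have "bloch_W a K \<epsilon> \<eta> \<omega> \<psi> k = w * of_real \<epsilon>"
    by (simp add: bloch_W_def T_def b_def)
  then show ?thesis using w(2) eps_pos by simp
qed

end

section \<open>Band limited and polynomial data\<close>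

text \<open>Nothing is assumed about \<open>h\<close> outside the interval. Cutting it off there
  leaves the product unchanged and makes it measurable.\<close>

lemma integrable_mult_continuous_on_support:
  fixes f h :: "real \<Rightarrow> complex"
  assumes f: "integrable lborel f" and supp: "\<And>k. f k \<noteq> 0 \<Longrightarrow> k \<in> {a..b}"
    and h: "continuous_on {a..b} h"
  shows "integrable lborel (\<lambda>k. f k * h k)"
proof -
  have "bounded (h ` {a..b})"
    by (intro compact_imp_bounded compact_continuous_image h) auto
  then obtain B where B: "\<And>k. k \<in> {a..b} \<Longrightarrow> norm (h k) \<le> B"
    unfolding bounded_iff by blast
  have eq: "(\<lambda>k. f k * h k) = (\<lambda>k. f k * (indicator {a..b} k *\<^sub>R h k))"
    using supp by (auto simp: indicator_def fun_eq_iff)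
  have [measurable]: "(\<lambda>k. indicator {a..b} k *\<^sub>R h k) \<in> borel_measurable lborel"
    using borel_measurable_continuous_on_indicator[OF _ h] by simp
  have [measurable]: "f \<in> borel_measurable lborel"
    using f by simp
  show ?thesis
  proof (rule Bochner_Integration.integrable_bound)
    show "integrable lborel (\<lambda>k. B * norm (f k))" using f by simp
    show "(\<lambda>k. f k * h k) \<in> borel_measurable lborel" unfolding eq by measurable
    show "AE k in lborel. norm (f k * h k) \<le> norm (B * norm (f k))"
    proof (rule AE_I2)
      fix k
      show "norm (f k * h k) \<le> norm (B * norm (f k))"
      proof (cases "f k = 0")
        case False
        then have "norm (h k) \<le> \<bar>B\<bar>" using B[OF supp] by fastforce
        then show ?thesis by (simp add: norm_mult abs_mult mult.commute[of "norm (f k)"] mult_right_mono)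
      qed simp
    qed
  qed
qed

text \<open>Riemann sums for \<open>\<integral> f(k) h(\<epsilon>k) dk\<close> whose weights \<open>c\<close> do not depend on \<open>h\<close>, so
  that the same sums serve for the data and for the flux.\<close>

lemma riemann_sum_approximation:
  fixes f :: "real \<Rightarrow> complex"
  assumes f: "integrable lborel f" and supp: "\<And>k. f k \<noteq> 0 \<Longrightarrow> \<epsilon> * k \<in> {-b..b}"
    and eps: "0 < \<epsilon>" and b: "0 \<le> b" and \<rho>: "0 < \<rho>"
  shows "\<exists>(I :: int set) c \<tau>. finite I \<and> I \<noteq> {} \<and> (\<forall>j\<in>I. \<tau> j \<in> {-b..b}) \<and>
    (\<forall>h \<delta>. continuous_on {-b..b} h \<longrightarrow>
       (\<forall>x\<in>{-b..b}. \<forall>y\<in>{-b..b}. \<bar>x - y\<bar> \<le> \<rho> \<longrightarrow> norm (h x - h y) \<le> \<delta>) \<longrightarrow>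
       norm ((\<Sum>j\<in>I. c j * h (\<tau> j)) - (\<integral>k. f k * h (\<epsilon> * k) \<partial>lborel)) \<le> \<delta> * (\<integral>k. norm (f k) \<partial>lborel))"
proof -
  \<comment> \<open>\<open>J k\<close> numbers the mesh cell of width \<rho> that contains
    \<open>\<epsilon> * k\<close>, counted from -b. \<tau> gives left end points and
    \<open>c\<close> the integrals of \<open>f\<close> over the cells; the last index also catches
    \<open>\<epsilon> * k = b\<close>.\<close>
  define J where "J = (\<lambda>k. \<lfloor>(\<epsilon> * k + b) / \<rho>\<rfloor>)"
  define I where "I = {0..\<lfloor>2 * b / \<rho>\<rfloor>}"
  define \<tau> where "\<tau> = (\<lambda>j::int. - b + \<rho> * of_int j)"
  define c where "c = (\<lambda>j. \<integral>k. indicator {k. J k = j} k *\<^sub>R f k \<partial>lborel)"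
  have J: "J k \<in> I" "\<tau> (J k) \<le> \<epsilon> * k" "\<epsilon> * k - \<tau> (J k) \<le> \<rho>" if "\<epsilon> * k \<in> {-b..b}" for k
  proof -
    have "0 \<le> (\<epsilon> * k + b) / \<rho>" "(\<epsilon> * k + b) / \<rho> \<le> 2 * b / \<rho>"
      using that \<rho> by (auto intro!: divide_right_mono)
    then show "J k \<in> I" unfolding J_def I_def by (auto intro: floor_mono)
    have "of_int (J k) \<le> (\<epsilon> * k + b) / \<rho>" "(\<epsilon> * k + b) / \<rho> < of_int (J k) + 1"
      unfolding J_def by linarith+
    then show "\<tau> (J k) \<le> \<epsilon> * k" "\<epsilon> * k - \<tau> (J k) \<le> \<rho>"
      using \<rho> by (auto simp: \<tau>_def field_simps)
  qed
  have \<tau>: "\<tau> j \<in> {-b..b}" if "j \<in> I" for j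
  proof -
    have "(0::real) \<le> of_int j" "of_int j \<le> 2 * b / \<rho>"
      using that by (auto simp: I_def le_floor_iff)
    then show ?thesis using \<rho> by (auto simp: \<tau>_def field_simps)
  qed
  have meas: "{k. J k = j} \<in> sets lborel" for j
    unfolding J_def floor_eq_iff by measurable
  have int_c: "integrable lborel (\<lambda>k. indicator {k. J k = j} k *\<^sub>R f k)" for j
    using integrable_mult_indicator[OF meas f] .
  have approx: "norm ((\<Sum>j\<in>I. c j * h (\<tau> j)) - (\<integral>k. f k * h (\<epsilon> * k) \<partial>lborel))
      \<le> \<delta> * (\<integral>k. norm (f k) \<partial>lborel)"
    if h: "continuous_on {-b..b} h"
      and mod: "\<forall>x\<in>{-b..b}. \<forall>y\<in>{-b..b}. \<bar>x - y\<bar> \<le> \<rho> \<longrightarrow> norm (h x - h y) \<le> \<delta>"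
    for h :: "real \<Rightarrow> complex" and \<delta>
  proof -
    \<comment> \<open>At most one summand survives, so the Riemann sum is exactly the integral of
      \<open>f\<close> against a step function and the error can be estimated pointwise.\<close>
    have step: "(\<Sum>j\<in>I. (indicator {k. J k = j} k *\<^sub>R f k) * h (\<tau> j)) = f k * h (\<tau> (J k))" for k
    proof (cases "f k = 0")
      case False
      then have "J k \<in> I" using J(1) supp by blast
      moreover have "(\<Sum>j\<in>I. (indicator {k. J k = j} k *\<^sub>R f k) * h (\<tau> j))
          = (\<Sum>j\<in>I. if j = J k then f k * h (\<tau> j) else 0)"
        by (intro sum.cong) (auto simp: indicator_def)
      ultimately show ?thesis by (simp add: I_def)
    qed simp
    have int1: "integrable lborel (\<lambda>k. f k * h (\<tau> (J k)))"
      unfolding step[symmetric] using int_c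
      by (intro Bochner_Integration.integrable_sum integrable_mult_left)
    have "(\<Sum>j\<in>I. c j * h (\<tau> j)) = (\<integral>k. f k * h (\<tau> (J k)) \<partial>lborel)"
      unfolding step[symmetric] c_def
      by (subst Bochner_Integration.integral_sum)
        (simp only: Bochner_Integration.integral_mult_left_zero | intro integrable_mult_left int_c)+
    moreover have int2: "integrable lborel (\<lambda>k. f k * h (\<epsilon> * k))"
    proof (rule integrable_mult_continuous_on_support[OF f])
      show "k \<in> {-b / \<epsilon>..b / \<epsilon>}" if "f k \<noteq> 0" for k
        using supp[OF that] eps by (auto simp: field_simps)
      show "continuous_on {-b / \<epsilon>..b / \<epsilon>} (\<lambda>k. h (\<epsilon> * k))"
        using eps by (intro continuous_on_compose2[OF h] continuous_intros) (auto simp: field_simps)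
    qed
    ultimately have "(\<Sum>j\<in>I. c j * h (\<tau> j)) - (\<integral>k. f k * h (\<epsilon> * k) \<partial>lborel)
        = (\<integral>k. f k * (h (\<tau> (J k)) - h (\<epsilon> * k)) \<partial>lborel)"
      using int1 by (simp add: right_diff_distrib)
    also have "norm \<dots> \<le> (\<integral>k. \<delta> * norm (f k) \<partial>lborel)"
    proof (rule Bochner_Integration.integral_norm_bound_integral)
      show "integrable lborel (\<lambda>k. f k * (h (\<tau> (J k)) - h (\<epsilon> * k)))"
        using int1 int2 by (simp add: right_diff_distrib)
      show "integrable lborel (\<lambda>k. \<delta> * norm (f k))" using f by simp
      fix k
      show "norm (f k * (h (\<tau> (J k)) - h (\<epsilon> * k))) \<le> \<delta> * norm (f k)"
      proof (cases "f k = 0")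
        case False
        have k: "\<epsilon> * k \<in> {-b..b}" using supp[OF False] .
        have "norm (h (\<tau> (J k)) - h (\<epsilon> * k)) \<le> \<delta>"
          using J[OF k] \<tau>[OF J(1)[OF k]] k by (intro mod[rule_format]) auto
        from mult_left_mono[OF this norm_ge_zero[of "f k"]] show ?thesis
          by (simp add: norm_mult mult.commute)
      qed simp
    qed
    finally show ?thesis by simp
  qed
  have "0 \<le> 2 * b / \<rho>" using b \<rho> by simp
  then have "finite I" "I \<noteq> {}" unfolding I_def by auto
  with \<tau> approx show ?thesis
    by (intro exI[of _ I] exI[of _ c] exI[of _ \<tau>] conjI ballI allI impI)
qed

section \<open>Taylor coefficients of polynomials and expansion of plane waves in k\<close>

lemma nth_vderiv_poly:
  "nth_vderiv n (\<lambda>x. poly P (of_real x :: complex)) = (\<lambda>x. poly ((pderiv ^^ n) P) (of_real x))"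
proof (induction n)
  case (Suc n)
  have "vector_derivative (\<lambda>x. poly q (of_real x :: complex)) (at x) = poly (pderiv q) (of_real x)" for q x
    by (intro vector_derivative_at has_vector_derivative_real_field poly_DERIV)
  then show ?case
    by (simp add: nth_vderiv_Suc Suc)
qed simp

lemma nth_vderiv_poly_0:
  "nth_vderiv n (\<lambda>x. poly P (of_real x :: complex)) 0 = fact n * coeff P n"
  by (simp add: nth_vderiv_poly poly_0_coeff_0 coeff_higher_pderiv pochhammer_fact)

context hmm_setting
begin

lemma plane_wave_add: "plane_wave (k + h) x = plane_wave k x * plane_wave h x"
  by (simp add: plane_wave_def exp_add[symmetric] algebra_simps add_divide_distrib)

lemma plane_wave_lipschitz: "norm (plane_wave k x - plane_wave k' x) \<le> \<bar>k - k'\<bar> * \<bar>x\<bar> / \<epsilon>"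
proof -
  have "norm (plane_wave h x - 1) \<le> \<bar>h\<bar> * \<bar>x\<bar> / \<epsilon>" for h
    using Taylor_exp[of "\<i> * of_real (h * x / \<epsilon>)" 0] eps_pos
    by (simp add: plane_wave_def norm_mult norm_divide)
  moreover have "plane_wave k x - plane_wave k' x = plane_wave k' x * (plane_wave (k - k') x - 1)"
    using plane_wave_add[of k' "k - k'" x] by (simp add: algebra_simps)
  ultimately show ?thesis by (simp add: norm_mult)
qed

text \<open>Once the factor of modulus 1 is split off, this is the first order Taylor remainder of
  exp at a purely imaginary point, where its exponential factor is 1.\<close>

lemma plane_wave_taylor:
  assumes "h \<noteq> 0"
  shows "norm ((plane_wave (k + h) x - plane_wave k x) / of_real h - \<i> * of_real (x / \<epsilon>) * plane_wave k x)
    \<le> \<bar>h\<bar> * (x / \<epsilon>)\<^sup>2"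
proof -
  define z where "z = \<i> * of_real (h * x / \<epsilon>)"
  have "(plane_wave (k + h) x - plane_wave k x) / of_real h - \<i> * of_real (x / \<epsilon>) * plane_wave k x
      = plane_wave k x * (exp z - 1 - z) / of_real h"
    using assms by (simp add: plane_wave_add z_def plane_wave_def[of h] field_simps)
  then have "norm ((plane_wave (k + h) x - plane_wave k x) / of_real h
      - \<i> * of_real (x / \<epsilon>) * plane_wave k x) = norm (exp z - 1 - z) / \<bar>h\<bar>"
    by (simp add: norm_mult norm_divide)
  also have "norm (exp z - 1 - z) \<le> (norm z)\<^sup>2"
    using Taylor_exp[of z 1] by (simp add: z_def diff_diff_eq numeral_2_eq_2)
  also have "(norm z)\<^sup>2 / \<bar>h\<bar> = \<bar>h\<bar> * (x / \<epsilon>)\<^sup>2"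
    using assms eps_pos by (simp add: z_def norm_mult norm_divide power2_eq_square field_simps)
  finally show ?thesis by (simp add: divide_right_mono)
qed

end

context hmm_flux_bounded
begin

text \<open>Plane waves depend on k in a Lipschitz way, uniformly on [-R, R], and the bound on the
  flux passes this on to \<open>F\<close>. One Riemann sum then approximates the data and the flux
  at once, and the relation is closed under uniform limits.\<close>

lemma flux_limit_band_limited:
  assumes F: "\<And>k. k \<in> {-b..b} \<Longrightarrow> flux_limit (plane_wave k) (F k)"
    and b: "0 \<le> b"
    and f: "integrable lborel f" and supp: "\<And>k. f k \<noteq> 0 \<Longrightarrow> \<epsilon> * k \<in> {-b..b}"
    and cont: "continuous_on {-R..R} (\<lambda>x. \<integral>k. f k * plane_wave (\<epsilon> * k) x \<partial>lborel)"
  shows "flux_limit (\<lambda>x. \<integral>k. f k * plane_wave (\<epsilon> * k) x \<partial>lborel) (\<integral>k. f k * F (\<epsilon> * k) \<partial>lborel)"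
proof -
  define M where "M = (\<integral>k. norm (f k) \<partial>lborel)"
  have M: "0 \<le> M" unfolding M_def by (intro Bochner_Integration.integral_nonneg) auto
  define D where "D = (2 * C + 1) * (1 + 2 * R)"
  have D: "0 < D" using C_pos R_pos by (simp add: D_def)
  \<comment> \<open>A common Lipschitz constant: \<open>R / \<epsilon>\<close> suffices for the
    plane waves, \<open>D * R / \<epsilon>\<close> for \<open>F\<close>.\<close>
  define \<Lambda> where "\<Lambda> = (D + 1) * R / \<epsilon>"
  have \<Lambda>: "0 < \<Lambda>" using D R_pos eps_pos by (simp add: \<Lambda>_def)
  have waveR: "norm (plane_wave k x - plane_wave k' x) \<le> \<bar>k - k'\<bar> * (R / \<epsilon>)"
    if "x \<in> {-R..R}" for k k' x
  proof -
    have "\<bar>k - k'\<bar> * \<bar>x\<bar> / \<epsilon> \<le> \<bar>k - k'\<bar> * R / \<epsilon>"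
      using that eps_pos by (intro divide_right_mono mult_left_mono) auto
    then show ?thesis using plane_wave_lipschitz[of k x k'] by simp
  qed
  have wave: "norm (plane_wave k x - plane_wave k' x) \<le> \<Lambda> * \<bar>k - k'\<bar>" if "x \<in> {-R..R}" for k k' x
  proof -
    have "R / \<epsilon> \<le> \<Lambda>" using D R_pos eps_pos by (simp add: \<Lambda>_def divide_right_mono)
    then have "\<bar>k - k'\<bar> * (R / \<epsilon>) \<le> \<bar>k - k'\<bar> * \<Lambda>" by (intro mult_left_mono) auto
    then show ?thesis using waveR[OF that, of k k'] by (simp add: mult.commute)
  qed
  have lipF: "norm (F k - F k') \<le> \<Lambda> * \<bar>k - k'\<bar>" if "k \<in> {-b..b}" "k' \<in> {-b..b}" for k k'
  proof (cases "k = k'")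
    \<comment> \<open>Distinct wave numbers give the strictly positive bound that
      \<open>flux_limit_uniform_bound\<close> asks for.\<close>
    case False
    have "norm (F k - F k') \<le> D * (\<bar>k - k'\<bar> * (R / \<epsilon>))"
      unfolding D_def
      using False R_pos eps_pos waveR
      by (intro flux_limit_uniform_bound[OF flux_limit_diff[OF F[OF that(1)] F[OF that(2)]]]) auto
    also have "\<dots> \<le> (D + 1) * (\<bar>k - k'\<bar> * (R / \<epsilon>))"
      using R_pos eps_pos by (intro mult_right_mono) auto
    finally show ?thesis by (simp add: \<Lambda>_def mult_ac)
  qed simp
  have contF: "continuous_on {-b..b} F"
  proof (rule continuous_onI)
    fix k e :: real assume k: "k \<in> {-b..b}" and e: "0 < e"
    show "\<exists>d>0. \<forall>k'\<in>{-b..b}. dist k' k < d \<longrightarrow> dist (F k') (F k) \<le> e"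
    proof (intro exI conjI ballI impI)
      show "0 < e / \<Lambda>" using e \<Lambda> by simp
      fix k' assume "k' \<in> {-b..b}" "dist k' k < e / \<Lambda>"
      then show "dist (F k') (F k) \<le> e"
        using lipF[OF _ k, of k'] \<Lambda> by (auto simp: dist_norm field_simps)
    qed
  qed
  have cont_wave: "continuous_on X (\<lambda>k. plane_wave k x)" for x X
    unfolding plane_wave_def using eps_pos by (intro continuous_intros) auto
  have approx: "\<exists>g w. flux_limit g w
      \<and> (\<forall>x\<in>{-R..R}. norm (g x - (\<integral>k. f k * plane_wave (\<epsilon> * k) x \<partial>lborel)) \<le> \<delta>)
      \<and> norm (w - (\<integral>k. f k * F (\<epsilon> * k) \<partial>lborel)) \<le> \<delta>" if \<delta>: "0 < \<delta>" for \<delta>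
  proof -
    \<comment> \<open>The mesh width for which both errors are at most \<delta>;
      \<open>M + 1\<close> covers \<open>M = 0\<close>.\<close>
    define \<rho> where "\<rho> = \<delta> / (\<Lambda> * (M + 1))"
    have \<rho>: "0 < \<rho>" using \<delta> \<Lambda> M by (simp add: \<rho>_def)
    have le: "\<Lambda> * \<rho> * M \<le> \<delta>"
    proof -
      have "\<Lambda> * \<rho> * M \<le> \<Lambda> * \<rho> * (M + 1)" using \<Lambda> \<rho> by simp
      also have "\<dots> = \<delta>" using \<Lambda> M by (simp add: \<rho>_def)
      finally show ?thesis .
    qed
    obtain I :: "int set" and c \<tau> where I: "finite I" "I \<noteq> {}" "\<And>j. j \<in> I \<Longrightarrow> \<tau> j \<in> {-b..b}"
      and sums: "\<And>h \<delta>. continuous_on {-b..b} h \<Longrightarrow>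
       \<forall>x\<in>{-b..b}. \<forall>y\<in>{-b..b}. \<bar>x - y\<bar> \<le> \<rho> \<longrightarrow> norm (h x - h y) \<le> \<delta> \<Longrightarrow>
       norm ((\<Sum>j\<in>I. c j * h (\<tau> j)) - (\<integral>k. f k * h (\<epsilon> * k) \<partial>lborel)) \<le> \<delta> * M"
      using riemann_sum_approximation[OF f supp eps_pos b \<rho>] unfolding M_def by blast
    have lam: "\<Lambda> * \<bar>x - y\<bar> \<le> \<Lambda> * \<rho>" if "\<bar>x - y\<bar> \<le> \<rho>" for x y
      using that \<Lambda> by simp
    have "flux_limit (\<lambda>x. \<Sum>j\<in>I. c j * plane_wave (\<tau> j) x) (\<Sum>j\<in>I. c j * F (\<tau> j))"
      by (intro flux_limit_sum flux_limit_cmult F I)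
    moreover have "norm ((\<Sum>j\<in>I. c j * plane_wave (\<tau> j) x)
        - (\<integral>k. f k * plane_wave (\<epsilon> * k) x \<partial>lborel)) \<le> \<delta>" if x: "x \<in> {-R..R}" for x
      using sums[OF cont_wave[of _ x], of "\<Lambda> * \<rho>"] order_trans[OF wave[OF x] lam] le
      by (meson order_trans)
    moreover have "norm ((\<Sum>j\<in>I. c j * F (\<tau> j)) - (\<integral>k. f k * F (\<epsilon> * k) \<partial>lborel)) \<le> \<delta>"
      using sums[OF contF, of "\<Lambda> * \<rho>"] order_trans[OF lipF lam] le
      by (meson order_trans)
    ultimately show ?thesis by blast
  qed
  from flux_limit_uniform_closed[OF cont] approx show ?thesis by blast
qed

text \<open>Difference quotients in k converge uniformly on [-R, R], and their fluxes converge to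
  \<open>F'\<close>. The prefactor \<open>p\<close> makes the statement iterable, since each
  derivative contributes another factor of x.\<close>

lemma flux_limit_derivative:
  assumes F: "\<And>k. k \<in> {-b<..<b} \<Longrightarrow> flux_limit (\<lambda>x. p x * plane_wave k x) (F k)"
    and p: "continuous_on {-R..R} p" and k: "k \<in> {-b<..<b}"
    and F': "(F has_vector_derivative F') (at k)"
  shows "flux_limit (\<lambda>x. (\<i> * of_real (x / \<epsilon>)) * p x * plane_wave k x) F'"
proof (rule flux_limit_uniform_closed)
  show "continuous_on {-R..R} (\<lambda>x. (\<i> * of_real (x / \<epsilon>)) * p x * plane_wave k x)"
    using eps_pos by (intro continuous_intros p continuous_on_plane_wave) auto
  fix \<delta> :: real assume \<delta>: "0 < \<delta>"
  have "bounded (p ` {-R..R})"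
    by (intro compact_imp_bounded compact_continuous_image p) auto
  then obtain B where B: "0 < B" "\<And>x. x \<in> {-R..R} \<Longrightarrow> norm (p x) \<le> B"
    unfolding bounded_pos by auto
  obtain d where d: "0 < d" "\<And>y. norm (y - k) < d \<Longrightarrow>
      norm (F y - F k - (y - k) *\<^sub>R F') \<le> \<delta> * norm (y - k)"
    using F' \<delta> unfolding has_vector_derivative_def has_derivative_at_alt by blast
  define m where "m = B * (R / \<epsilon>)\<^sup>2"
  have m: "0 < m" using B(1) R_pos eps_pos by (simp add: m_def)
  \<comment> \<open>The bounds serve, in this order, the differentiability of \<open>F\<close>,
    staying inside the open interval, and the Taylor remainder, which is at most
    \<open>m * h\<close>.\<close>
  define h where "h = min (d / 2) (min ((b - k) / 2) (\<delta> / m))"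
  have "0 < h" using d(1) k \<delta> m by (simp add: h_def)
  moreover have "h \<le> d / 2" unfolding h_def by (rule min.cobounded1)
  moreover have "h \<le> (b - k) / 2" unfolding h_def by (rule min.coboundedI2[OF min.cobounded1])
  moreover have "h \<le> \<delta> / m" unfolding h_def by (rule min.coboundedI2[OF min.cobounded2])
  ultimately have h: "0 < h" "h < d" "k + h \<in> {-b<..<b}" "h \<le> \<delta> / m"
    using d(1) k by auto
  have "flux_limit (\<lambda>x. (1 / of_real h) * (p x * plane_wave (k + h) x - p x * plane_wave k x))
      ((1 / of_real h) * (F (k + h) - F k))"
    by (intro flux_limit_cmult flux_limit_diff F h k)
  moreover have "norm ((1 / of_real h) * (p x * plane_wave (k + h) x - p x * plane_wave k x)
      - (\<i> * of_real (x / \<epsilon>)) * p x * plane_wave k x) \<le> \<delta>" if x: "x \<in> {-R..R}" for x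
  proof -
    have "(1 / of_real h) * (p x * plane_wave (k + h) x - p x * plane_wave k x)
        - (\<i> * of_real (x / \<epsilon>)) * p x * plane_wave k x
      = p x * ((plane_wave (k + h) x - plane_wave k x) / of_real h - \<i> * of_real (x / \<epsilon>) * plane_wave k x)"
      by (simp add: algebra_simps diff_divide_distrib)
    then have "norm ((1 / of_real h) * (p x * plane_wave (k + h) x - p x * plane_wave k x)
        - (\<i> * of_real (x / \<epsilon>)) * p x * plane_wave k x)
      = norm (p x) * norm ((plane_wave (k + h) x - plane_wave k x) / of_real h
          - \<i> * of_real (x / \<epsilon>) * plane_wave k x)"
      by (simp only: norm_mult)
    also have "\<dots> \<le> B * (\<bar>h\<bar> * (x / \<epsilon>)\<^sup>2)"
      using B h(1) x plane_wave_taylor[of h k x] by (intro mult_mono) auto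
    also have "\<dots> \<le> B * (h * (R / \<epsilon>)\<^sup>2)"
    proof -
      have "(x / \<epsilon>)\<^sup>2 \<le> (R / \<epsilon>)\<^sup>2"
        unfolding power_divide using x by (intro divide_right_mono) (auto intro!: abs_le_square_iff[THEN iffD1])
      then show ?thesis using B(1) h(1) by (simp add: mult_left_mono)
    qed
    also have "\<dots> = m * h" by (simp add: m_def)
    also have "\<dots> \<le> \<delta>" using h(4) m by (simp add: field_simps)
    finally show ?thesis .
  qed
  moreover have "norm ((1 / of_real h) * (F (k + h) - F k) - F') \<le> \<delta>"
  proof -
    have "(1 / of_real h) * (F (k + h) - F k) - F' = (F (k + h) - F k - h *\<^sub>R F') / of_real h"
      using h(1) by (simp add: field_simps scaleR_conv_of_real)
    then show ?thesis
      using d(2)[of "k + h"] h by (simp add: norm_divide field_simps)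
  qed
  ultimately show "\<exists>g w. flux_limit g w
      \<and> (\<forall>x\<in>{-R..R}. norm (g x - (\<i> * of_real (x / \<epsilon>)) * p x * plane_wave k x) \<le> \<delta>)
      \<and> norm (w - F') \<le> \<delta>"
    by blast
qed

text \<open>Each derivative in k brings down a factor of i x / \<epsilon>. The induction runs over
  all k in the open interval, because a derivative at 0 needs neighbouring values; k = 0 and the
  normalisation come last.\<close>

lemma flux_limit_monomial:
  assumes W: "\<And>k. k \<in> {-b<..<b} \<Longrightarrow> flux_limit (plane_wave k) (W k / of_real \<epsilon>)"
    and b: "0 < b" and Ck: "Ck_on r W {-b<..<b}" and j: "j \<le> r"
  shows "flux_limit (\<lambda>x. of_real x ^ j) ((of_real \<epsilon> / \<i>) ^ j * (nth_vderiv j W 0 / of_real \<epsilon>))"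
proof -
  have "flux_limit (\<lambda>x. (\<i> * of_real (x / \<epsilon>)) ^ j * plane_wave k x) (nth_vderiv j W k / of_real \<epsilon>)"
    if "k \<in> {-b<..<b}" for k
    using j that
  proof (induction j arbitrary: k)
    case 0
    then show ?case using W by simp
  next
    case (Suc j)
    have "((\<lambda>k. nth_vderiv j W k / of_real \<epsilon>) has_vector_derivative
        nth_vderiv (Suc j) W k / of_real \<epsilon>) (at k)"
      using Suc.prems by (intro has_vector_derivative_divide Ck_on_has_vector_derivative[OF Ck]) auto
    then have "flux_limit (\<lambda>x. (\<i> * of_real (x / \<epsilon>)) * (\<i> * of_real (x / \<epsilon>)) ^ j * plane_wave k x)
        (nth_vderiv (Suc j) W k / of_real \<epsilon>)"
      using Suc eps_pos by (intro flux_limit_derivative[where b = b]) (auto intro!: continuous_intros)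
    then show ?case by simp
  qed
  from flux_limit_cmult[OF this[of 0], of "(of_real \<epsilon> / \<i>) ^ j"] show ?thesis
    using b eps_pos by (simp add: plane_wave_def power_mult_distrib[symmetric])
qed

end

theorem theorem3:
  fixes a K :: "real \<Rightarrow> real" and \<epsilon> \<eta> :: real and p q :: nat
    and \<omega> :: "nat \<Rightarrow> real \<Rightarrow> real" and \<psi> :: "nat \<Rightarrow> real \<Rightarrow> real \<Rightarrow> complex"
    and W :: "real \<Rightarrow> complex"
  assumes a_C1: "Ck_on 1 a UNIV"
    and a_periodic: "\<And>y. a (y + 1) = a y"
    and a_pos: "\<exists>c>0. \<forall>y. c \<le> a y"
    and scales: "0 < \<epsilon>" "\<epsilon> \<le> \<eta>"
    and kernel: "K \<in> kernel_space p q" "q \<ge> 1"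
    and bloch: "bloch_waves a \<omega> \<psi>"
    and W_def: "W = bloch_W a K \<epsilon> \<eta> \<omega> \<psi>"
    and W_L2: "L2_on {-pi<..<pi} W"
  shows "(\<forall>Q Qhat v. band_limited (pi / \<epsilon>) Q Qhat \<longrightarrow> wave_solution a \<epsilon> Q v \<longrightarrow>
            hmm_flux a K \<epsilon> \<eta> v = 1 / of_real \<epsilon> * (\<integral>k. Qhat k * W (\<epsilon> * k) \<partial>lborel))
       \<and> (\<forall>(P :: complex poly) Q r v. degree P = r \<longrightarrow> Q = (\<lambda>x. poly P (of_real x)) \<longrightarrow>
            Ck_on r W {-pi<..<pi} \<longrightarrow> wave_solution a \<epsilon> Q v \<longrightarrow>
            hmm_flux a K \<epsilon> \<eta> v =
              (\<Sum>j\<le>r. of_real (\<epsilon> powi (int j - 1)) * flux_coeff W j * nth_vderiv j Q 0))"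
proof -
  have K_supp: "K x = 0" if "1 < \<bar>x\<bar>" for x
  proof (rule ccontr)
    assume "K x \<noteq> 0"
    then have "x \<in> closure {x. K x \<noteq> 0}" by (intro subsetD[OF closure_subset]) simp
    moreover have "closure {x. K x \<noteq> 0} \<subseteq> {-1..1}"
      using kernel by (simp add: kernel_space_def)
    ultimately have "x \<in> {-1..1}" by (rule subsetD[rotated])
    then show False using that by auto
  qed
  interpret hmm_setting a K \<epsilon> \<eta>
  proof
    show "0 < a y" for y using a_pos by (meson less_le_trans)
    show "Ck_on 1 K UNIV"
      by (rule Ck_on_antimono[of q]) (use kernel in \<open>auto simp: kernel_space_def\<close>)
    show "a (y + 1) = a y" for y by (rule a_periodic)
    show "K x = 0" if "1 < \<bar>x\<bar>" for x by (rule K_supp[OF that])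
  qed (use a_C1 scales in linarith | rule a_C1)+
  obtain R C where "hmm_flux_bounded a K \<epsilon> \<eta> R C"
    using hmm_flux_bounded_ex by blast
  then interpret hmm_flux_bounded a K \<epsilon> \<eta> R C .
  have W: "flux_limit (plane_wave k) (W k / of_real \<epsilon>)" if "k \<in> {-pi..pi}" for k
    unfolding W_def by (rule flux_limit_plane_wave[OF bloch that])
  show ?thesis
  proof (intro conjI allI impI)
    fix Q Qhat v
    assume band: "band_limited (pi / \<epsilon>) Q Qhat" and sol: "wave_solution a \<epsilon> Q v"
    have supp: "\<epsilon> * k \<in> {-pi..pi}" if "Qhat k \<noteq> 0" for k
    proof -
      have "k \<in> closure {k. Qhat k \<noteq> 0}" using that by (intro subsetD[OF closure_subset]) simp
      moreover have "closure {k. Qhat k \<noteq> 0} \<subseteq> {-(pi / \<epsilon>)..pi / \<epsilon>}"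
        using band by (simp add: band_limited_def)
      ultimately have "k \<in> {-(pi / \<epsilon>)..pi / \<epsilon>}" by (rule subsetD[rotated])
      then show ?thesis using eps_pos by (auto simp: field_simps)
    qed
    \<comment> \<open>Frequency k of the Fourier integral is Bloch wave number
      \<open>\<epsilon> * k\<close>.\<close>
    have Q: "Q = (\<lambda>x. \<integral>k. Qhat k * plane_wave (\<epsilon> * k) x \<partial>lborel)"
      using band eps_pos by (auto simp: band_limited_def plane_wave_def fun_eq_iff mult.commute)
    have "flux_limit Q (\<integral>k. Qhat k * (W (\<epsilon> * k) / of_real \<epsilon>) \<partial>lborel)"
      using band continuous_on_initial_data[OF sol] unfolding Q
      by (intro flux_limit_band_limited[OF W _ _ supp]) (auto simp: band_limited_def)
    \<comment> \<open>The flux of the given solution is one value belonging to Q, the integral is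
      another.\<close>
    from flux_limit_unique[OF flux_limit_solution[OF sol] this]
    show "hmm_flux a K \<epsilon> \<eta> v = 1 / of_real \<epsilon> * (\<integral>k. Qhat k * W (\<epsilon> * k) \<partial>lborel)"
      by simp
  next
    fix P :: "complex poly" and Q r v
    assume deg: "degree P = r" and Q: "Q = (\<lambda>x. poly P (of_real x))"
      and Ck: "Ck_on r W {-pi<..<pi}" and sol: "wave_solution a \<epsilon> Q v"
    have "flux_limit (\<lambda>x. \<Sum>j\<in>{..r}. coeff P j * of_real x ^ j)
        (\<Sum>j\<in>{..r}. coeff P j * ((of_real \<epsilon> / \<i>) ^ j * (nth_vderiv j W 0 / of_real \<epsilon>)))"
      by (intro flux_limit_sum flux_limit_cmult flux_limit_monomial[OF W _ Ck]) auto
    moreover have "(\<lambda>x. \<Sum>j\<in>{..r}. coeff P j * of_real x ^ j) = Q"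
      by (simp add: Q poly_altdef deg)
    \<comment> \<open>The factorial in \<open>nth_vderiv j Q 0\<close> cancels the one in
      \<open>flux_coeff\<close>, and dividing by \<epsilon> lowers its power to j - 1.\<close>
    moreover have "coeff P j * ((of_real \<epsilon> / \<i>) ^ j * (nth_vderiv j W 0 / of_real \<epsilon>))
        = of_real (\<epsilon> powi (int j - 1)) * flux_coeff W j * nth_vderiv j Q 0" for j
    proof -
      have "of_real (\<epsilon> powi (int j - 1)) = (of_real \<epsilon> ^ j / of_real \<epsilon> :: complex)"
        using eps_pos by (simp add: power_int_diff)
      then show ?thesis
        unfolding Q nth_vderiv_poly_0 flux_coeff_def power_divide by (simp add: power_int_minus divide_inverse)
    qed
    ultimately show "hmm_flux a K \<epsilon> \<eta> v =
        (\<Sum>j\<le>r. of_real (\<epsilon> powi (int j - 1)) * flux_coeff W j * nth_vderiv j Q 0)"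
      using flux_limit_unique[OF flux_limit_solution[OF sol]] by simp
  qed
qed

end
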